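(* There are absolute constants $C_1, C_2 > 0$ such that the following holds. Let $n \geq 4$ be an integer and let $k$ be a positive integer with $k \leq n^{1/3}$. Then there exist a polytope $P_k \subset \mathbb{R}^X$ with at most $C_1 n^{4k}$ vertices and a constant $c_k$ with $$\left| c_k - \frac{k}{n} \right| \leq \frac{C_2}{n}$$ (that is, $P_k$ has $O(n^{4k})$ vertices and $c_k = \frac{k}{n} + O\left(\frac1n\right)$) such that $$c_k (Q - \mathbf{1}) \subset (P_k \cap L) - \mathbf{1} \subset Q - \mathbf{1}.$$
   Context: Let $K_n$ be the complete graph on the vertex set $\{1,\dots,n\}$. A Hamiltonian cycle in $K_n$ is a cycle visiting every vertex exactly once (cycles are undirected and have no distinguished starting point). To a Hamiltonian cycle associate its incidence matrix $(a_{ij}) \in \mathbb{R}^{n^2}$ (an $n \times n$ matrix), where $a_{ij} = 1$ if the cycle contains the edge $\{i,j\}$ and $a_{ij}=0$ otherwise. Let $X$ denote the set of all these matrices (identified with the set of Hamiltonian cycles in $K_n$). Let $\mathbb{R}^X$ be the vector space of all functions $f : X \to \mathbb{R}$, and let $L \subset \mathbb{R}^X$ be the subspace of restrictions to $X$ of linear functions on $\mathbb{R}^{n^2}$, i.e. functions of the form $f(x) = \langle c, x\rangle$ for some matrix $c$. Define $$Q = \Big\{ f \in L : f(x) \geq 0 \text{ for all } x \in X, \ \frac{1}{|X|} \sum_{x \in X} f(x) = 1 \Big\}.$$ $\mathbf{1} \in \mathbb{R}^X$ denotes the function with $\mathbf{1}(x) = 1$ for all $x \in X$. For a set $S$, a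 vector $v$ and a scalar $c$, $S - v = \{s - v : s \in S\}$ and $cS = \{cs : s\in S\}$. *)

theory Defs
  imports "HOL-Analysis.Analysis" "HOL-Analysis.Finite_Function_Topology"
begin

section \<open>Hamiltonian cycles\<close>

text \<open>An undirected graph is given by its edges, which are two-element sets of vertices.\<close>

definition complete_edges :: "nat \<Rightarrow> nat set set" where
  "complete_edges n = {{i, j} | i j. i \<in> {1..n} \<and> j \<in> {1..n} \<and> i \<noteq> j}"

definition closed_walk_edges :: "'a list \<Rightarrow> 'a set set" where
  "closed_walk_edges vs = {{vs ! i, vs ! (Suc i mod length vs)} | i. i < length vs}"

text \<open>A cycle is represented by its set of edges, so that it carries neither an orientation
  nor a starting point.\<close>

definition hamiltonian_cycles :: "'a set \<Rightarrow> 'a set set \<Rightarrow> 'a set set set" where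
  "hamiltonian_cycles V E =
     {closed_walk_edges vs | vs.
        3 \<le> length vs \<and> distinct vs \<and> set vs = V \<and> closed_walk_edges vs \<subseteq> E}"

text \<open>An \<open>n \<times> n\<close> matrix is a function of two indices in \<open>{1..n}\<close>.  Outside this range the
  incidence matrix of a cycle in \<open>K\<^sub>n\<close> is \<open>0\<close>, so distinct functions are distinct matrices.\<close>

type_synonym matrix = "nat \<Rightarrow> nat \<Rightarrow> real"

definition incidence_matrix :: "nat set set \<Rightarrow> matrix" where
  "incidence_matrix C = (\<lambda>i j. if {i, j} \<in> C then 1 else 0)"

definition ham_matrices :: "nat \<Rightarrow> matrix set" where
  "ham_matrices n = incidence_matrix ` hamiltonian_cycles {1..n} (complete_edges n)"

definition matrix_inner :: "nat \<Rightarrow> matrix \<Rightarrow> matrix \<Rightarrow> real" where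
  "matrix_inner n c x = (\<Sum>i\<in>{1..n}. \<Sum>j\<in>{1..n}. c i j * x i j)"

section \<open>The space of functions on a finite set\<close>

text \<open>For finite \<open>X\<close>, the space \<open>\<real>\<^sup>X\<close> is the subspace of those finitely supported functions whose
  support is contained in \<open>X\<close>.  The type of finitely supported functions is a real vector space
  under the pointwise operations, so convex hulls and polytopes are available.  (The constant
  \<open>1\<close> of this type is not the function \<open>\<one>\<close>, which is \<open>const_one\<close> below.)\<close>

definition function_space :: "'a set \<Rightarrow> ('a \<Rightarrow>\<^sub>0 real) set" where
  "function_space X = {f. Poly_Mapping.keys f \<subseteq> X}"

definition const_one :: "'a set \<Rightarrow> ('a \<Rightarrow>\<^sub>0 real)" where
  "const_one X = (\<Sum>x\<in>X. Poly_Mapping.single x 1)"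

lemma lookup_const_one:
  assumes "finite X"
  shows "Poly_Mapping.lookup (const_one X) x = (if x \<in> X then 1 else 0)"
  using assms by (simp add: const_one_def lookup_sum lookup_single when_def)

lemma function_space_realizes:
  assumes "finite X"
  obtains f where "f \<in> function_space X" "\<And>x. x \<in> X \<Longrightarrow> Poly_Mapping.lookup f x = g x"
proof
  let ?f = "\<Sum>x\<in>X. Poly_Mapping.single x (g x)"
  have *: "Poly_Mapping.lookup ?f x = (if x \<in> X then g x else 0)" for x
    using assms by (simp add: lookup_sum lookup_single when_def)
  show "?f \<in> function_space X"
    by (auto simp: function_space_def in_keys_iff * split: if_splits)
  show "Poly_Mapping.lookup ?f x = g x" if "x \<in> X" for x
    using that by (simp add: *)
qed

lemma finite_ham_matrices: "finite (ham_matrices n)"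
proof -
  have "complete_edges n \<subseteq> Pow {1..n}"
    by (auto simp: complete_edges_def)
  then have "hamiltonian_cycles {1..n} (complete_edges n) \<subseteq> Pow (Pow {1..n})"
    by (auto simp: hamiltonian_cycles_def)
  then have "finite (hamiltonian_cycles {1..n} (complete_edges n))"
    by (rule finite_subset) simp
  then show ?thesis
    by (simp add: ham_matrices_def)
qed

section \<open>The subspace \<open>L\<close> and the convex set \<open>Q\<close>\<close>

definition linear_restrictions :: "nat \<Rightarrow> (matrix \<Rightarrow>\<^sub>0 real) set" where
  "linear_restrictions n =
     {f \<in> function_space (ham_matrices n).
        \<exists>c. \<forall>x\<in>ham_matrices n. Poly_Mapping.lookup f x = matrix_inner n c x}"

definition nonneg_mean_one :: "nat \<Rightarrow> (matrix \<Rightarrow>\<^sub>0 real) set" where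
  "nonneg_mean_one n =
     {f \<in> linear_restrictions n.
        (\<forall>x\<in>ham_matrices n. 0 \<le> Poly_Mapping.lookup f x) \<and>
        1 / real (card (ham_matrices n)) * (\<Sum>x\<in>ham_matrices n. Poly_Mapping.lookup f x) = 1}"

end

theory Submission
  imports Defs
begin

text \<open>
  Permutations \<open>\<sigma>\<close> of \<open>{1..n}\<close> act on matrices by relabelling, and the set \<open>X\<close> of matrices of
  Hamiltonian cycles is the orbit of the matrix of the standard cycle \<open>1, 2, \<dots>, n, 1\<close>; write
  \<open>M \<sigma>\<close> for its relabelling by \<open>\<sigma>\<close>.  Call a non-negative function on \<open>X\<close> with mean \<open>1\<close> a density,
  so that \<open>Q\<close> consists of the densities in \<open>L\<close>.  If \<open>P\<close> is the convex hull of densities, then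
  \<open>P \<inter> L \<subseteq> Q\<close> holds automatically, and the task is to find few densities whose convex hull
  contains \<open>\<one> + c (f - \<one>)\<close> for every \<open>f \<in> Q\<close>.

  They come from a smoothing operator.  Fix \<open>m\<close> with \<open>2 m \<le> n\<close>, and let \<open>R\<close> (\<open>pairings\<close>) be the set
  of permutations \<open>\<rho>\<close> that map each of the first \<open>m\<close> edges of the matching
  \<open>{1,2}, {3,4}, \<dots>\<close> to an edge of this matching.  Let \<open>T f (M \<pi>)\<close> be the average of
  \<open>f (M (\<pi> \<circ> \<sigma> \<circ> \<rho>))\<close> over the automorphisms \<open>\<sigma>\<close> of the standard cycle and over \<open>\<rho> \<in> R\<close>.  Collecting
  the terms with \<open>\<pi> \<circ> \<sigma> \<circ> \<rho> = \<tau>\<close> writes \<open>T f\<close>, for \<open>f \<in> Q\<close>, as the convex combination with weights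
  \<open>f (M \<tau>) / n!\<close> of densities \<open>p \<tau>\<close>.  Here \<open>p \<tau>\<close> is the distribution of the cycle
  \<open>M (\<tau> \<circ> \<rho>\<^sup>-\<^sup>1)\<close> for a uniformly random \<open>\<rho> \<in> R\<close>; these cycles all contain the edges \<open>{\<tau> 1, \<tau> 2}, {\<tau> 3, \<tau> 4}, \<dots>\<close>
  (\<open>lookup_average\<close>).  The definition of \<open>R\<close> constrains only the values at \<open>1, \<dots>, 2 m\<close>, so \<open>p \<tau>\<close>
  depends only on the restriction of \<open>\<tau>\<close> to these points, and there are at most \<open>n ^ (2 m)\<close>
  densities \<open>p \<tau>\<close> (\<open>card_pairing_densities\<close>).

  On \<open>L\<close> the operator is \<open>T f = a f + (1 - a) \<one>\<close>.  Indeed \<open>T\<close> commutes with relabelling, so it is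
  described by the probability \<open>avg_links n m i j\<close> that \<open>i\<close> and \<open>j\<close> are adjacent in the image of the
  standard cycle under a random \<open>\<sigma> \<circ> \<rho>\<close>, and it suffices that this probability takes one value \<open>A\<close>
  on the edges of the standard cycle and one value \<open>B\<close> on all its non-edges.  The former holds by
  rotating.  For the latter, \<open>R\<close> is invariant under composition with every permutation that
  preserves the matching, and these permutations act transitively on pairs of points from
  different edges of the matching.  Points that are not adjacent on the cycle are never matched.
  For odd \<open>n\<close> the matching misses the point \<open>n\<close>, but after a random rotation every point is the
  missed one with the same probability (\<open>avg_links_nonadjacent\<close>).

  To bound \<open>a = A - B\<close> from below, note that every vertex has degree two, so
  \<open>2 A + (n - 3) B = 2\<close>, while at least \<open>m\<close> of the \<open>n\<close> edges of the cycle stay edges under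
  \<open>\<rho> \<in> R\<close>, so \<open>A \<ge> m / n\<close>.  This gives \<open>a \<ge> (m - 2) / n\<close> for \<open>m \<ge> 3\<close> (\<open>avg_links_affine\<close>).  Take
  \<open>m = k\<close>, which leaves room for \<open>k\<close> disjoint pairs because \<open>k ^ 3 \<le> n\<close>, and shrink towards \<open>\<one>\<close> to
  reach \<open>c = (k - 2) / n\<close>.  For \<open>k \<le> 2\<close> the polytope \<open>{\<one>}\<close> and \<open>c = 0\<close> suffice.
\<close>

section \<open>Hamiltonian cycles as relabellings of one cycle\<close>

abbreviation perms :: "nat \<Rightarrow> (nat \<Rightarrow> nat) set" where
  "perms n \<equiv> {\<sigma>. \<sigma> permutes {1..n}}"

definition step :: "nat \<Rightarrow> nat \<Rightarrow> nat" where
  "step n i = (if i \<in> {1..n} then if i = n then 1 else Suc i else i)"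

text \<open>The adjacency matrix of the standard cycle \<open>1, 2, \<dots>, n, 1\<close>.\<close>

definition cyc :: "nat \<Rightarrow> matrix" where
  "cyc n i j = (if i \<in> {1..n} \<and> j \<in> {1..n} \<and> (j = step n i \<or> i = step n j) then 1 else 0)"

definition relabel :: "(nat \<Rightarrow> nat) \<Rightarrow> matrix \<Rightarrow> matrix" where
  "relabel \<sigma> A = (\<lambda>u v. A (inv \<sigma> u) (inv \<sigma> v))"

lemma finite_perms: "finite (perms n)"
  by (simp add: finite_permutations)

lemma id_in_perms: "id \<in> perms n"
  by (simp add: permutes_id)

lemma comp_in_perms: "\<sigma> \<in> perms n \<Longrightarrow> \<tau> \<in> perms n \<Longrightarrow> \<sigma> \<circ> \<tau> \<in> perms n"
  by (simp add: permutes_compose)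

lemma inv_in_perms: "\<sigma> \<in> perms n \<Longrightarrow> inv \<sigma> \<in> perms n"
  by (simp add: permutes_inv)

lemma perms_inverses:
  assumes "\<sigma> \<in> perms n"
  shows "\<sigma> (inv \<sigma> i) = i" "inv \<sigma> (\<sigma> i) = i" "inv (inv \<sigma>) = \<sigma>" "\<sigma> \<circ> inv \<sigma> = id" "inv \<sigma> \<circ> \<sigma> = id"
  using assms permutes_inverses[of \<sigma> "{1..n}"] permutes_inv_inv[of \<sigma> "{1..n}"]
  by (auto simp: fun_eq_iff)

lemma inv_comp_perms:
  assumes "\<sigma> \<in> perms n" "\<tau> \<in> perms n"
  shows "inv (\<sigma> \<circ> \<tau>) = inv \<tau> \<circ> inv \<sigma>"
  using assms by (auto intro!: o_inv_distrib permutes_bij)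

lemma perms_mem_iff: "\<sigma> \<in> perms n \<Longrightarrow> \<sigma> i \<in> {1..n} \<longleftrightarrow> i \<in> {1..n}"
  using permutes_in_image[of \<sigma> "{1..n}" i] by blast

lemma inv_perms_mem_iff: "\<sigma> \<in> perms n \<Longrightarrow> inv \<sigma> i \<in> {1..n} \<longleftrightarrow> i \<in> {1..n}"
  using perms_mem_iff[OF inv_in_perms] by blast

lemma perms_eq_iff: "\<sigma> \<in> perms n \<Longrightarrow> \<sigma> i = \<sigma> j \<longleftrightarrow> i = j"
  by (metis perms_inverses(2))

lemma relabel_comp:
  assumes "\<sigma> \<in> perms n" "\<tau> \<in> perms n"
  shows "relabel (\<sigma> \<circ> \<tau>) A = relabel \<sigma> (relabel \<tau> A)"
  using inv_comp_perms[OF assms] by (simp add: relabel_def)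

lemma relabel_inject:
  assumes "\<sigma> \<in> perms n"
  shows "relabel \<sigma> A = relabel \<sigma> B \<longleftrightarrow> A = B"
proof
  assume *: "relabel \<sigma> A = relabel \<sigma> B"
  show "A = B"
  proof (intro ext)
    fix i j
    show "A i j = B i j"
      using fun_cong[OF fun_cong[OF *, of "\<sigma> i"], of "\<sigma> j"] assms
      by (simp add: relabel_def permutes_inverses)
  qed
qed simp

lemma step_in_perms: "step n \<in> perms n"
proof -
  have "step n permutes {1..n}"
  proof (rule bij_imp_permutes)
    have inj: "inj_on (step n) {1..n}"
      by (auto simp: inj_on_def step_def split: if_splits)
    have "step n ` {1..n} \<subseteq> {1..n}"
      by (auto simp: step_def)
    then have "step n ` {1..n} = {1..n}"
      using inj by (rule endo_inj_surj[OF finite_atLeastAtMost])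
    then show "bij_betw (step n) {1..n} {1..n}"
      using inj by (simp only: bij_betw_def)
  qed (auto simp: step_def)
  then show ?thesis by simp
qed

text \<open>The rotation \<open>step n\<close> acts transitively on \<open>{1..n}\<close>.\<close>

lemma step_invariant_const:
  assumes "\<And>i. g (step n i) = g i" and "i \<in> {1..n}"
  shows "g i = g 1"
proof -
  have "1 \<le> i \<Longrightarrow> i \<le> n \<Longrightarrow> g i = g 1"
  proof (induction i rule: nat_induct_at_least)
    case (Suc j)
    then have "step n j = Suc j"
      by (simp add: step_def)
    then show ?case
      using assms(1)[of j] Suc by simp
  qed simp
  then show ?thesis using assms(2) by simp
qed

lemma cyc_sym: "cyc n i j = cyc n j i"
  by (auto simp: cyc_def)

lemma cyc_nonneg: "0 \<le> cyc n i j"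
  by (simp add: cyc_def)

lemma cyc_step: "cyc n (step n i) (step n j) = cyc n i j"
  using perms_eq_iff[OF step_in_perms] perms_mem_iff[OF step_in_perms]
  unfolding cyc_def by presburger

lemma cyc_refl: "n \<ge> 2 \<Longrightarrow> cyc n i i = 0"
  by (auto simp: cyc_def step_def)

lemma cyc_cases: "cyc n i j = 0 \<or> cyc n i j = 1"
  by (simp add: cyc_def)

lemma cyc_row_sum:
  assumes "3 \<le> n" "i \<in> {1..n}"
  shows "(\<Sum>j\<in>{1..n}. cyc n i j) = 2"
proof -
  define p where "p = inv (step n) i"
  have p: "p \<in> {1..n}" "i = step n j \<longleftrightarrow> j = p" for j
    using assms(2) inv_perms_mem_iff[OF step_in_perms] perms_inverses[OF step_in_perms]
    by (auto simp: p_def)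
  have s: "step n i \<in> {1..n}"
    using assms(2) perms_mem_iff[OF step_in_perms] by blast
  have ne: "step n i \<noteq> p"
    using assms p(2)[of "step n i"] by (auto simp: step_def split: if_splits)
  have "(\<Sum>j\<in>{1..n}. cyc n i j) =
      (\<Sum>j\<in>{1..n}. (if j = step n i then 1 else 0) + (if j = p then 1 else 0))"
    using assms(2) ne by (intro sum.cong) (auto simp: cyc_def p(2))
  also have "\<dots> = 2"
    using s p(1) by (simp add: sum.distrib)
  finally show ?thesis .
qed

lemma cyc_eq_1_iff:
  "cyc n i j = 1 \<longleftrightarrow> (\<exists>p\<in>{1..n}. (p = i \<and> step n p = j) \<or> (p = j \<and> step n p = i))"
proof -
  have "cyc n i j = 1 \<longleftrightarrow> i \<in> {1..n} \<and> j \<in> {1..n} \<and> (j = step n i \<or> i = step n j)"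
    by (simp add: cyc_def)
  then show ?thesis
    using perms_mem_iff[OF step_in_perms, of n] by blast
qed

text \<open>Both inclusions of \<open>ham_matrices_eq\<close> reduce to this formula, once the vertex list of a cycle is
  written as the values of a permutation.\<close>

lemma incidence_closed_walk:
  assumes \<sigma>: "\<sigma> \<in> perms n" and n: "n \<ge> 1"
  shows "incidence_matrix (closed_walk_edges (map \<sigma> [1..<Suc n])) = relabel \<sigma> (cyc n)"
    and "closed_walk_edges (map \<sigma> [1..<Suc n]) = (\<lambda>p. {\<sigma> p, \<sigma> (step n p)}) ` {1..n}"
proof -
  have nth: "map \<sigma> [1..<Suc n] ! (Suc i mod n) = \<sigma> (step n (Suc i))"
       "map \<sigma> [1..<Suc n] ! i = \<sigma> (Suc i)" if "i < n" for i
  proof -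
    have "Suc i mod n < n"
      using n by simp
    then have "map \<sigma> [1..<Suc n] ! (Suc i mod n) = \<sigma> (Suc (Suc i mod n))"
      by (simp del: upt_Suc)
    then show "map \<sigma> [1..<Suc n] ! (Suc i mod n) = \<sigma> (step n (Suc i))"
      using that by (cases "Suc i = n") (auto simp: step_def)
    show "map \<sigma> [1..<Suc n] ! i = \<sigma> (Suc i)"
      using that by (simp del: upt_Suc)
  qed
  have len: "length (map \<sigma> [1..<Suc n]) = n"
    by (simp only: length_map length_upt diff_Suc_Suc diff_zero One_nat_def)
  have "closed_walk_edges vs = (\<lambda>i. {vs ! i, vs ! (Suc i mod length vs)}) ` {..<length vs}" for vs :: "nat list"
    by (auto simp: closed_walk_edges_def)
  then have "closed_walk_edges (map \<sigma> [1..<Suc n]) =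
      (\<lambda>i. {map \<sigma> [1..<Suc n] ! i, map \<sigma> [1..<Suc n] ! (Suc i mod n)}) ` {..<n}"
    by (simp only: len)
  also have "\<dots> = (\<lambda>i. {\<sigma> (Suc i), \<sigma> (step n (Suc i))}) ` {..<n}"
    by (rule image_cong) (simp_all only: nth lessThan_iff)
  also have "\<dots> = (\<lambda>p. {\<sigma> p, \<sigma> (step n p)}) ` Suc ` {..<n}"
    by (simp add: image_image)
  also have "Suc ` {..<n} = {1..n}"
    by (simp add: image_Suc_lessThan)
  finally show *: "closed_walk_edges (map \<sigma> [1..<Suc n]) = (\<lambda>p. {\<sigma> p, \<sigma> (step n p)}) ` {1..n}" .
  have "{u, v} \<in> (\<lambda>p. {\<sigma> p, \<sigma> (step n p)}) ` {1..n} \<longleftrightarrow> cyc n (inv \<sigma> u) (inv \<sigma> v) = 1" for u v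
  proof -
    have eq: "\<sigma> p = u \<longleftrightarrow> p = inv \<sigma> u" for u p
      using perms_inverses[OF \<sigma>] by metis
    have "{u, v} \<in> (\<lambda>p. {\<sigma> p, \<sigma> (step n p)}) ` {1..n} \<longleftrightarrow>
        (\<exists>p\<in>{1..n}. (\<sigma> p = u \<and> \<sigma> (step n p) = v) \<or> (\<sigma> p = v \<and> \<sigma> (step n p) = u))"
      by (auto simp: image_iff doubleton_eq_iff)
    also have "\<dots> \<longleftrightarrow> cyc n (inv \<sigma> u) (inv \<sigma> v) = 1"
      unfolding eq cyc_eq_1_iff by blast
    finally show ?thesis .
  qed
  then have "(if {u, v} \<in> (\<lambda>p. {\<sigma> p, \<sigma> (step n p)}) ` {1..n} then 1 else 0) =
      cyc n (inv \<sigma> u) (inv \<sigma> v)" for u v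
    using cyc_cases[of n "inv \<sigma> u" "inv \<sigma> v"] by presburger
  then show "incidence_matrix (closed_walk_edges (map \<sigma> [1..<Suc n])) = relabel \<sigma> (cyc n)"
    unfolding * incidence_matrix_def relabel_def by (intro ext)
qed

text \<open>A closed walk is the standard one with its \<open>i\<close>-th vertex renamed, so all Hamiltonian cycles form
  a single orbit.  Everything below is expressed through permutations, with the standard cycle as
  base point.\<close>

lemma ham_matrices_eq:
  assumes n: "n \<ge> 3"
  shows "ham_matrices n = (\<lambda>\<sigma>. relabel \<sigma> (cyc n)) ` perms n"
proof (intro subset_antisym subsetI)
  fix x assume "x \<in> ham_matrices n"
  then obtain vs where vs: "distinct vs" "set vs = {1..n}"
      and x: "x = incidence_matrix (closed_walk_edges vs)"
    by (auto simp: ham_matrices_def hamiltonian_cycles_def)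
  have len: "length vs = n"
    using distinct_card[OF vs(1)] vs(2) by simp
  define \<sigma> where "\<sigma> i = (if i \<in> {1..n} then vs ! (i - 1) else i)" for i
  have map: "map \<sigma> [1..<Suc n] = vs"
    by (rule nth_equalityI) (auto simp: len \<sigma>_def simp del: upt_Suc)
  have "\<sigma> ` {1..n} = {1..n}"
  proof -
    have "\<sigma> ` set [1..<Suc n] = set vs"
      by (simp only: map flip: set_map)
    then show ?thesis
      using vs(2) by (simp add: atLeastLessThanSuc_atLeastAtMost del: upt_Suc)
  qed
  then have "bij_betw \<sigma> {1..n} {1..n}"
    by (simp add: bij_betw_def eq_card_imp_inj_on)
  then have "\<sigma> \<in> perms n"
    by (auto intro!: bij_imp_permutes simp: \<sigma>_def)
  then show "x \<in> (\<lambda>\<sigma>. relabel \<sigma> (cyc n)) ` perms n"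
    using incidence_closed_walk(1)[of \<sigma> n] n map x by auto
next
  fix x assume "x \<in> (\<lambda>\<sigma>. relabel \<sigma> (cyc n)) ` perms n"
  then obtain \<sigma> where \<sigma>: "\<sigma> \<in> perms n" and x: "x = relabel \<sigma> (cyc n)"
    by blast
  let ?vs = "map \<sigma> [1..<Suc n]"
  have "inj_on \<sigma> A" for A
    using perms_eq_iff[OF \<sigma>] by (auto simp: inj_on_def)
  then have "distinct ?vs"
    by (simp add: distinct_map del: upt_Suc)
  moreover have "set ?vs = {1..n}"
    using \<sigma> permutes_image[of \<sigma> "{1..n}"]
    by (simp add: atLeastLessThanSuc_atLeastAtMost del: upt_Suc)
  moreover have "closed_walk_edges ?vs \<subseteq> complete_edges n"
  proof -
    have "{\<sigma> p, \<sigma> (step n p)} \<in> complete_edges n" if "p \<in> {1..n}" for p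
    proof -
      have "p \<noteq> step n p"
        using n that by (auto simp: step_def)
      then have "\<sigma> p \<noteq> \<sigma> (step n p)"
        using perms_eq_iff[OF \<sigma>] by blast
      moreover have "\<sigma> p \<in> {1..n}" "\<sigma> (step n p) \<in> {1..n}"
        using that perms_mem_iff[OF \<sigma>] perms_mem_iff[OF step_in_perms] by blast+
      ultimately show ?thesis
        unfolding complete_edges_def by blast
    qed
    then show ?thesis
      using incidence_closed_walk(2)[OF \<sigma>] n by auto
  qed
  ultimately have "closed_walk_edges ?vs \<in> hamiltonian_cycles {1..n} (complete_edges n)"
    unfolding hamiltonian_cycles_def using n
    by (auto simp del: upt_Suc intro!: exI[of _ ?vs])
  then show "x \<in> ham_matrices n"
    unfolding ham_matrices_def x using incidence_closed_walk(1)[OF \<sigma>] n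
    by (intro image_eqI[of _ _ "closed_walk_edges ?vs"]) auto
qed

section \<open>Permutations that pair up the first vertices\<close>

text \<open>The pairs \<open>{1,2}, {3,4}, \<dots>\<close> are the classes of equal \<open>block\<close>; for odd \<open>n\<close> the last class meets
  \<open>{1..n}\<close> in the single point \<open>n\<close>, which is called unpaired.\<close>

definition block :: "nat \<Rightarrow> nat" where
  "block i = (i + 1) div 2"

definition partner :: "nat \<Rightarrow> nat" where
  "partner i = (if odd i then i + 1 else i - 1)"

definition pairings :: "nat \<Rightarrow> nat \<Rightarrow> (nat \<Rightarrow> nat) set" where
  "pairings n m = {\<rho> \<in> perms n. \<forall>i\<in>{1..2*m}. block (\<rho> (partner i)) = block (\<rho> i)}"

text \<open>Up to normalization, the probability that \<open>i\<close> and \<open>j\<close> are adjacent in the image of the standard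
  cycle under a random pairing.\<close>

definition links :: "nat \<Rightarrow> nat \<Rightarrow> nat \<Rightarrow> nat \<Rightarrow> real" where
  "links n m i j = (\<Sum>\<rho>\<in>pairings n m. cyc n (inv \<rho> i) (inv \<rho> j))"

definition unpaired :: "nat \<Rightarrow> nat \<Rightarrow> bool" where
  "unpaired n i \<longleftrightarrow> i = n \<and> odd n"

lemma block_partner_even: "block (2 * k) = k" "partner (2 * k) = 2 * k - 1"
  by (simp_all add: block_def partner_def)

lemma block_partner_odd: "block (2 * k + 1) = k + 1" "partner (2 * k + 1) = 2 * k + 2"
  by (simp_all add: block_def partner_def)

lemma block_eq_iff:
  assumes "1 \<le> i"
  shows "block j = block i \<longleftrightarrow> j = i \<or> j = partner i"
proof -
  consider a b where "i = 2 * a" "j = 2 * b" | a b where "i = 2 * a" "j = 2 * b + 1"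
    | a b where "i = 2 * a + 1" "j = 2 * b" | a b where "i = 2 * a + 1" "j = 2 * b + 1"
    by (cases "even i"; cases "even j") (auto elim!: evenE oddE)
  then show ?thesis
  proof cases
    case 1
    show ?thesis
      using assms unfolding 1 block_partner_even by arith
  next
    case 2
    show ?thesis
      using assms unfolding 2 block_partner_even block_partner_odd by arith
  next
    case 3
    show ?thesis
      unfolding 3 block_partner_even block_partner_odd by arith
  next
    case 4
    show ?thesis
      unfolding 4 block_partner_odd by arith
  qed
qed

lemma block_partner: "1 \<le> i \<Longrightarrow> block (partner i) = block i"
  using block_eq_iff by blast

lemma partner_mem:
  assumes "i \<in> {1..n}" "\<not> unpaired n i"
  shows "partner i \<in> {1..n}"
proof (cases "even i")
  case True
  then have "i \<noteq> 1"
    by auto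
  with True assms show ?thesis
    by (auto simp: partner_def)
next
  case False
  then have "i \<noteq> n"
    using assms by (auto simp: unpaired_def)
  with False assms show ?thesis
    by (simp add: partner_def)
qed

lemma partner_cyc:
  assumes "i \<in> {1..n}" "partner i \<in> {1..n}"
  shows "cyc n i (partner i) = 1"
proof (cases "even i")
  case True
  then have "step n (partner i) = i"
    using assms by (auto simp: partner_def step_def)
  then show ?thesis
    using assms by (simp add: cyc_def)
next
  case False
  then have "step n i = partner i"
    using assms by (auto simp: partner_def step_def)
  then show ?thesis
    using assms by (simp add: cyc_def)
qed

lemma pairings_subset: "pairings n m \<subseteq> perms n"
  by (auto simp: pairings_def)

lemma finite_pairings: "finite (pairings n m)"
  using finite_subset[OF pairings_subset finite_perms] .

lemma id_in_pairings: "id \<in> pairings n m"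
  by (auto simp: pairings_def permutes_id block_partner)

lemma comp_in_pairings:
  assumes "\<rho> \<in> pairings n m" "\<pi> \<in> perms n"
    and "\<And>x y. block (\<pi> x) = block (\<pi> y) \<longleftrightarrow> block x = block y"
  shows "\<pi> \<circ> \<rho> \<in> pairings n m"
  using assms by (auto simp: pairings_def permutes_compose)

lemma links_sym: "links n m i j = links n m j i"
  by (simp add: links_def cyc_sym)

text \<open>Composing a pairing with a block-preserving permutation gives a pairing again, so the sum may be
  reindexed.\<close>

lemma links_block_invariant:
  assumes \<pi>: "\<pi> \<in> perms n"
    and bl: "\<And>x y. block (\<pi> x) = block (\<pi> y) \<longleftrightarrow> block x = block y"
  shows "links n m (\<pi> i) (\<pi> j) = links n m i j"
  unfolding links_def
proof (rule sum.reindex_bij_witness[of _ "\<lambda>\<rho>. \<pi> \<circ> \<rho>" "\<lambda>\<rho>. inv \<pi> \<circ> \<rho>"])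
  have bl': "block (inv \<pi> x) = block (inv \<pi> y) \<longleftrightarrow> block x = block y" for x y
    using bl[of "inv \<pi> x" "inv \<pi> y"] perms_inverses[OF \<pi>] by simp
  fix \<rho> assume \<rho>: "\<rho> \<in> pairings n m"
  then have \<rho>': "\<rho> \<in> perms n"
    using pairings_subset by blast
  show "\<pi> \<circ> (inv \<pi> \<circ> \<rho>) = \<rho>" "inv \<pi> \<circ> (\<pi> \<circ> \<rho>) = \<rho>"
    using perms_inverses[OF \<pi>] by (auto simp: fun_eq_iff)
  show "inv \<pi> \<circ> \<rho> \<in> pairings n m" "\<pi> \<circ> \<rho> \<in> pairings n m"
    using comp_in_pairings[OF \<rho>] \<pi> inv_in_perms[OF \<pi>] bl bl' by blast+
  show "cyc n (inv (inv \<pi> \<circ> \<rho>) i) (inv (inv \<pi> \<circ> \<rho>) j) = cyc n (inv \<rho> (\<pi> i)) (inv \<rho> (\<pi> j))"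
    using inv_comp_perms[OF inv_in_perms[OF \<pi>] \<rho>'] perms_inverses[OF \<pi>] by simp
qed

text \<open>If \<open>j\<close> and \<open>j'\<close> are partners, exchange them; otherwise exchange their blocks as wholes.  Either
  way the block of \<open>i\<close> stays fixed.\<close>

lemma block_perm_exists:
  assumes i: "block i \<noteq> block j" "block i \<noteq> block j'"
    and j: "j \<in> {1..n}" "\<not> unpaired n j" and j': "j' \<in> {1..n}" "\<not> unpaired n j'"
  obtains \<pi> where "\<pi> \<in> perms n" "\<forall>x y. block (\<pi> x) = block (\<pi> y) \<longleftrightarrow> block x = block y"
    "\<pi> i = i" "\<pi> j = j'"
proof (cases "block j = block j'")
  case True
  have bl: "block (Transposition.transpose j j' x) = block x" for x
    using True by (auto simp: Transposition.transpose_def)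
  show thesis
  proof (rule that)
    show "Transposition.transpose j j' \<in> perms n"
      using j(1) j'(1) by (simp only: mem_Collect_eq permutes_swap_id)
    show "\<forall>x y. block (Transposition.transpose j j' x) = block (Transposition.transpose j j' y) \<longleftrightarrow> block x = block y"
      by (simp add: bl)
    show "Transposition.transpose j j' i = i"
      using i by (auto simp: Transposition.transpose_def)
    show "Transposition.transpose j j' j = j'"
      by (simp only: transpose_apply_first)
  qed
next
  case False
  define \<pi> where "\<pi> = Transposition.transpose (partner j) (partner j') \<circ> Transposition.transpose j j'"
  have ge: "1 \<le> j" "1 \<le> j'"
    using j(1) j'(1) by simp_all
  note bp = block_partner[OF ge(1)] block_partner[OF ge(2)]
  have ne: "j \<noteq> j'" "j \<noteq> partner j'" "partner j \<noteq> j'" "partner j \<noteq> partner j'"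
      "j \<noteq> partner j" "j' \<noteq> partner j'"
    using False bp ge by (auto simp: partner_def split: if_splits)
  have bl: "block (\<pi> x) = Transposition.transpose (block j) (block j') (block x)" for x
  proof -
    consider "x = j" | "x = partner j" | "x = j'" | "x = partner j'"
      | "block x \<noteq> block j" "block x \<noteq> block j'"
      using block_eq_iff[OF ge(1), of x] block_eq_iff[OF ge(2), of x] by blast
    then show ?thesis
      using False bp ne by cases (auto simp: \<pi>_def Transposition.transpose_def)
  qed
  show thesis
  proof (rule that)
    have "partner j \<in> {1..n}" "partner j' \<in> {1..n}"
      using partner_mem j j' by blast+
    then show "\<pi> \<in> perms n"
      using j(1) j'(1) unfolding \<pi>_def mem_Collect_eq
      by (intro permutes_compose permutes_swap_id)
    show "\<forall>x y. block (\<pi> x) = block (\<pi> y) \<longleftrightarrow> block x = block y"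
      unfolding bl by (intro allI inj_eq[OF inj_transpose])
    show "\<pi> i = i"
      using i bp by (auto simp: \<pi>_def Transposition.transpose_def)
    show "\<pi> j = j'"
      using ne by (auto simp: \<pi>_def Transposition.transpose_def)
  qed
qed

lemma links_move:
  assumes "block i \<noteq> block j" "block i \<noteq> block j'"
    and "j \<in> {1..n}" "\<not> unpaired n j" "j' \<in> {1..n}" "\<not> unpaired n j'"
  shows "links n m i j = links n m i j'"
proof -
  obtain \<pi> where "\<pi> \<in> perms n" "\<forall>x y. block (\<pi> x) = block (\<pi> y) \<longleftrightarrow> block x = block y"
    "\<pi> i = i" "\<pi> j = j'"
    using block_perm_exists[OF assms] .
  then show ?thesis
    using links_block_invariant[of \<pi> n m i j] by simp
qed

lemma unpaired_block:
  assumes "unpaired n i" "j \<in> {1..n}" "\<not> unpaired n j"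
  shows "block i \<noteq> block j"
proof
  assume *: "block i = block j"
  have "1 \<le> j" "1 \<le> i"
    using assms(1,2) by (auto simp: unpaired_def)
  then have "j = partner i"
    using block_eq_iff[of i j] * assms by auto
  then show False
    using assms by (auto simp: unpaired_def partner_def)
qed

text \<open>Move one endpoint at a time by \<open>links_move\<close>.  This needs intermediate pairs in different blocks,
  whence the cases: if both direct routes are blocked, the two pairs occupy the same two blocks in
  opposite order, and the route starts from \<open>(j, i)\<close> instead.\<close>

lemma links_paired_const:
  assumes ij: "block i \<noteq> block j" "i \<in> {1..n}" "\<not> unpaired n i" "j \<in> {1..n}" "\<not> unpaired n j"
    and ij': "block i' \<noteq> block j'" "i' \<in> {1..n}" "\<not> unpaired n i'" "j' \<in> {1..n}" "\<not> unpaired n j'"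
  shows "links n m i j = links n m i' j'"
proof -
  note mv = links_move[of _ _ _ n m]
  consider "block i \<noteq> block j'" | "block i' \<noteq> block j" | "block i = block j'" "block i' = block j"
    by blast
  then show ?thesis
  proof cases
    case 1
    have "links n m i j = links n m i j'"
      using mv 1 ij ij' by blast
    also have "\<dots> = links n m j' i'"
      using mv[of j' i i'] 1 ij ij' by (metis links_sym)
    finally show ?thesis by (simp add: links_sym)
  next
    case 2
    have "links n m j i = links n m j i'"
      using mv[of j i i'] 2 ij ij' by metis
    also have "\<dots> = links n m i' j'"
      using mv[of i' j j'] 2 ij ij' by (metis links_sym)
    finally show ?thesis by (simp add: links_sym)
  next
    case 3
    have "links n m j i = links n m j j'"
      using mv[of j i j'] 3 ij ij' by metis
    also have "\<dots> = links n m j' i'"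
      using mv[of j' j i'] 3 ij ij' by (metis links_sym)
    finally show ?thesis by (simp add: links_sym)
  qed
qed

text \<open>Two points in different blocks cannot both be unpaired, so only the values with no and with one
  unpaired point occur.  The affine form in the two indicators is what averages well over
  rotations.\<close>

lemma links_different_blocks:
  "\<exists>\<beta> \<delta>. \<forall>i\<in>{1..n}. \<forall>j\<in>{1..n}. block i \<noteq> block j \<longrightarrow>
    links n m i j = \<beta> + \<delta> * (of_bool (unpaired n i) + of_bool (unpaired n j))"
proof -
  define good where "good i \<longleftrightarrow> i \<in> {1..n} \<and> \<not> unpaired n i" for i
  have "\<exists>\<beta>. \<forall>i j. good i \<and> good j \<and> block i \<noteq> block j \<longrightarrow> links n m i j = \<beta>"
  proof (cases "\<exists>i j. good i \<and> good j \<and> block i \<noteq> block j")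
    case True
    then obtain i' j' where ij': "good i'" "good j'" "block i' \<noteq> block j'"
      by metis
    have "links n m i j = links n m i' j'" if "good i \<and> good j \<and> block i \<noteq> block j" for i j
      using links_paired_const[of i j n i' j' m] ij' that by (simp add: good_def)
    then show ?thesis by metis
  qed metis
  then obtain \<beta> where \<beta>: "\<forall>i j. good i \<and> good j \<and> block i \<noteq> block j \<longrightarrow> links n m i j = \<beta>" ..
  have "\<exists>\<gamma>. \<forall>j. unpaired n n \<and> good j \<longrightarrow> links n m n j = \<gamma>"
  proof (cases "\<exists>j. good j")
    case True
    then obtain j' where j': "good j'"
      by metis
    have "links n m n j = links n m n j'" if "unpaired n n \<and> good j" for j
      using links_move[of n j j' n m] unpaired_block[of n n] j' that by (simp add: good_def)
    then show ?thesis by metis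
  qed metis
  then obtain \<gamma> where \<gamma>: "\<forall>j. unpaired n n \<and> good j \<longrightarrow> links n m n j = \<gamma>" ..
  show ?thesis
  proof (rule exI[of _ \<beta>], rule exI[of _ "\<gamma> - \<beta>"], intro ballI impI)
    fix i j assume ij: "i \<in> {1..n}" "j \<in> {1..n}" "block i \<noteq> block j"
    consider "good i" "good j" | "good i" "j = n" "unpaired n n" | "i = n" "unpaired n n" "good j"
      using ij unfolding good_def unpaired_def by metis
    then show "links n m i j = \<beta> + (\<gamma> - \<beta>) * (of_bool (unpaired n i) + of_bool (unpaired n j))"
    proof cases
      case 1
      then show ?thesis using \<beta> ij by (simp add: good_def)
    next
      case 2
      then show ?thesis using \<gamma> links_sym[of n m i j] by (simp add: good_def)
    next
      case 3
      then show ?thesis using \<gamma> by (simp add: good_def)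
    qed
  qed
qed

section \<open>Averaging over the symmetries of the cycle\<close>

definition auts :: "nat \<Rightarrow> (nat \<Rightarrow> nat) set" where
  "auts n = {\<sigma> \<in> perms n. relabel \<sigma> (cyc n) = cyc n}"

text \<open>The probability that \<open>i\<close> and \<open>j\<close> are adjacent in the image of the standard cycle under \<open>\<sigma> \<circ> \<rho>\<close>, for
  independent uniformly random \<open>\<sigma>\<close> in \<open>auts n\<close> and \<open>\<rho>\<close> in \<open>pairings n m\<close>.\<close>

definition avg_links :: "nat \<Rightarrow> nat \<Rightarrow> nat \<Rightarrow> nat \<Rightarrow> real" where
  "avg_links n m i j =
     (\<Sum>\<sigma>\<in>auts n. links n m (inv \<sigma> i) (inv \<sigma> j)) / (real (card (auts n)) * real (card (pairings n m)))"

lemma auts_subset: "auts n \<subseteq> perms n"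
  by (auto simp: auts_def)

lemma finite_auts: "finite (auts n)"
  using finite_subset[OF auts_subset finite_perms] .

lemma auts_cyc:
  assumes "\<sigma> \<in> auts n"
  shows "cyc n (\<sigma> i) (\<sigma> j) = cyc n i j" "cyc n (inv \<sigma> i) (inv \<sigma> j) = cyc n i j"
proof -
  have *: "cyc n (inv \<sigma> u) (inv \<sigma> v) = cyc n u v" for u v
    using assms by (auto simp: auts_def relabel_def fun_eq_iff)
  then show "cyc n (inv \<sigma> i) (inv \<sigma> j) = cyc n i j" .
  show "cyc n (\<sigma> i) (\<sigma> j) = cyc n i j"
    using *[of "\<sigma> i" "\<sigma> j"] assms perms_inverses(2)[of \<sigma> n] by (simp add: auts_def)
qed

lemma id_in_auts: "id \<in> auts n"
  by (simp add: auts_def permutes_id relabel_def)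

lemma step_in_auts: "step n \<in> auts n"
proof -
  have "cyc n (inv (step n) i) (inv (step n) j) = cyc n i j" for i j
    using cyc_step[of n "inv (step n) i" "inv (step n) j"] perms_inverses[OF step_in_perms] by simp
  then show ?thesis
    using step_in_perms by (simp add: auts_def relabel_def)
qed

lemma comp_in_auts: "\<sigma> \<in> auts n \<Longrightarrow> \<tau> \<in> auts n \<Longrightarrow> \<sigma> \<circ> \<tau> \<in> auts n"
  using comp_in_perms[of \<sigma> n \<tau>] relabel_comp[of \<sigma> n \<tau> "cyc n"] by (auto simp: auts_def)

lemma inv_in_auts: "\<sigma> \<in> auts n \<Longrightarrow> inv \<sigma> \<in> auts n"
  using inv_in_perms[of \<sigma> n] auts_cyc[of \<sigma> n] perms_inverses(3)[of \<sigma> n]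
  by (auto simp: auts_def relabel_def)

text \<open>Rotations are automorphisms of the cycle, so the average over all automorphisms does not see them.\<close>

lemma sum_auts_step:
  fixes h :: "nat \<Rightarrow> nat \<Rightarrow> real"
  shows "(\<Sum>\<sigma>\<in>auts n. h (inv \<sigma> (step n i)) (inv \<sigma> (step n j))) = (\<Sum>\<sigma>\<in>auts n. h (inv \<sigma> i) (inv \<sigma> j))"
proof (rule sum.reindex_bij_witness[of _ "\<lambda>\<sigma>. step n \<circ> \<sigma>" "\<lambda>\<sigma>. inv (step n) \<circ> \<sigma>"])
  note si = perms_inverses[OF step_in_perms[of n]]
  fix \<sigma> assume \<sigma>: "\<sigma> \<in> auts n"
  show "step n \<circ> (inv (step n) \<circ> \<sigma>) = \<sigma>" "inv (step n) \<circ> (step n \<circ> \<sigma>) = \<sigma>"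
    using si by (auto simp: fun_eq_iff)
  show "inv (step n) \<circ> \<sigma> \<in> auts n" "step n \<circ> \<sigma> \<in> auts n"
    using \<sigma> comp_in_auts inv_in_auts step_in_auts by blast+
  have "inv (inv (step n) \<circ> \<sigma>) = inv \<sigma> \<circ> step n"
    using inv_comp_perms[OF inv_in_perms[OF step_in_perms], of \<sigma> n] \<sigma> auts_subset si by auto
  then show "h (inv (inv (step n) \<circ> \<sigma>) i) (inv (inv (step n) \<circ> \<sigma>) j) =
      h (inv \<sigma> (step n i)) (inv \<sigma> (step n j))"
    by simp
qed

lemma avg_links_sym: "avg_links n m i j = avg_links n m j i"
  by (simp add: avg_links_def links_sym)

lemma avg_links_refl: "n \<ge> 2 \<Longrightarrow> avg_links n m i i = 0"
  by (simp add: avg_links_def links_def cyc_refl)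

lemma avg_links_adjacent:
  assumes "cyc n i j = 1"
  shows "avg_links n m i j = avg_links n m 1 (step n 1)"
proof -
  have *: "avg_links n m i (step n i) = avg_links n m 1 (step n 1)" if "i \<in> {1..n}" for i
    using step_invariant_const[of "\<lambda>i. avg_links n m i (step n i)" n i] that
    by (simp add: avg_links_def sum_auts_step)
  have "i \<in> {1..n}" "j \<in> {1..n}" "j = step n i \<or> i = step n j"
    using assms by (auto simp: cyc_def split: if_splits)
  then show ?thesis
    using *[of i] *[of j] avg_links_sym[of n m i j] by auto
qed

text \<open>An automorphism keeps \<open>i\<close> and \<open>j\<close> non-adjacent, and points of the same block are adjacent, so
  \<open>links_different_blocks\<close> applies to every term.  The unpaired point is hit equally often by the
  preimages of every point, which turns the affine expression into a constant.\<close>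

lemma avg_links_nonadjacent:
  "\<exists>B. \<forall>i\<in>{1..n}. \<forall>j\<in>{1..n}. i \<noteq> j \<longrightarrow> cyc n i j = 0 \<longrightarrow> avg_links n m i j = B"
proof -
  obtain \<beta> \<delta> where l: "\<forall>i\<in>{1..n}. \<forall>j\<in>{1..n}. block i \<noteq> block j \<longrightarrow>
    links n m i j = \<beta> + \<delta> * (of_bool (unpaired n i) + of_bool (unpaired n j))"
    using links_different_blocks[of n m] by (elim exE)
  define U :: "nat \<Rightarrow> real" where "U i = (\<Sum>\<sigma>\<in>auts n. of_bool (unpaired n (inv \<sigma> i)))" for i
  have "U (step n i) = U i" for i
    using sum_auts_step[of "\<lambda>a b. of_bool (unpaired n a)" n i 1] by (simp only: U_def)
  then have U: "U i = U 1" if "i \<in> {1..n}" for i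
    using that by (rule step_invariant_const)
  let ?B = "(real (card (auts n)) * \<beta> + \<delta> * (2 * U 1)) / (real (card (auts n)) * real (card (pairings n m)))"
  show ?thesis
  proof (rule exI[of _ ?B], intro ballI impI)
    fix i j assume ij: "i \<in> {1..n}" "j \<in> {1..n}" "i \<noteq> j" "cyc n i j = 0"
    have "links n m (inv \<sigma> i) (inv \<sigma> j) =
        \<beta> + \<delta> * (of_bool (unpaired n (inv \<sigma> i)) + of_bool (unpaired n (inv \<sigma> j)))"
      if \<sigma>: "\<sigma> \<in> auts n" for \<sigma>
    proof (rule l[rule_format])
      have \<sigma>': "\<sigma> \<in> perms n"
        using \<sigma> auts_subset by blast
      show mem: "inv \<sigma> i \<in> {1..n}" "inv \<sigma> j \<in> {1..n}"
        using ij inv_perms_mem_iff[OF \<sigma>'] by auto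
      have "inv \<sigma> i \<noteq> inv \<sigma> j"
        using ij(3) perms_inverses[OF \<sigma>'] by metis
      moreover have "cyc n (inv \<sigma> i) (inv \<sigma> j) = 0"
        using auts_cyc[OF \<sigma>] ij(4) by simp
      ultimately show "block (inv \<sigma> i) \<noteq> block (inv \<sigma> j)"
        using block_eq_iff[of "inv \<sigma> i" "inv \<sigma> j"] partner_cyc[of "inv \<sigma> i" n] mem by auto
    qed
    then have "(\<Sum>\<sigma>\<in>auts n. links n m (inv \<sigma> i) (inv \<sigma> j)) =
        real (card (auts n)) * \<beta> + \<delta> * (U i + U j)"
      by (simp add: U_def sum.distrib sum_distrib_left distrib_left)
    then show "avg_links n m i j = ?B"
      using U[OF ij(1)] U[OF ij(2)] by (simp add: avg_links_def)
  qed
qed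

lemma sum_perms:
  assumes "\<sigma> \<in> perms n"
  shows "(\<Sum>j\<in>{1..n}. f (\<sigma> j)) = (\<Sum>j\<in>{1..n}. f j)"
  using assms by (auto intro!: sum.permute[symmetric, unfolded o_def])

lemma card_auts_pos: "0 < card (auts n)"
  unfolding card_gt_0_iff using finite_auts id_in_auts by blast

lemma card_pairings_pos: "0 < card (pairings n m)"
  unfolding card_gt_0_iff using finite_pairings id_in_pairings by blast

text \<open>Every relabelled cycle is 2-regular.\<close>

lemma avg_links_row_sum:
  assumes "3 \<le> n" "i \<in> {1..n}"
  shows "(\<Sum>j\<in>{1..n}. avg_links n m i j) = 2"
proof -
  have row: "(\<Sum>j\<in>{1..n}. cyc n (inv \<rho> (inv \<sigma> i)) (inv \<rho> (inv \<sigma> j))) = 2"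
    if "\<sigma> \<in> auts n" "\<rho> \<in> pairings n m" for \<sigma> \<rho>
  proof -
    have p: "\<sigma> \<in> perms n" "\<rho> \<in> perms n"
      using that auts_subset pairings_subset by blast+
    have "(\<Sum>j\<in>{1..n}. cyc n (inv \<rho> (inv \<sigma> i)) (inv \<rho> (inv \<sigma> j))) =
        (\<Sum>j\<in>{1..n}. cyc n (inv \<rho> (inv \<sigma> i)) j)"
      using sum_perms[OF inv_in_perms[OF p(1)], of "\<lambda>j. cyc n (inv \<rho> (inv \<sigma> i)) (inv \<rho> j)"]
        sum_perms[OF inv_in_perms[OF p(2)], of "cyc n (inv \<rho> (inv \<sigma> i))"] by simp
    also have "\<dots> = 2"
      using assms(2) inv_perms_mem_iff[OF p(1)] inv_perms_mem_iff[OF p(2)]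
      by (intro cyc_row_sum[OF assms(1)]) blast
    finally show ?thesis .
  qed
  have "(\<Sum>j\<in>{1..n}. \<Sum>\<sigma>\<in>auts n. links n m (inv \<sigma> i) (inv \<sigma> j)) =
      (\<Sum>\<sigma>\<in>auts n. \<Sum>\<rho>\<in>pairings n m. \<Sum>j\<in>{1..n}. cyc n (inv \<rho> (inv \<sigma> i)) (inv \<rho> (inv \<sigma> j)))"
    unfolding links_def by (subst sum.swap) (intro sum.cong refl sum.swap)
  also have "\<dots> = real (card (auts n)) * (real (card (pairings n m)) * 2)"
    using row by simp
  finally show ?thesis
    using card_auts_pos[of n] card_pairings_pos[of n m]
    by (simp add: avg_links_def flip: sum_divide_distrib)
qed

text \<open>For each pairing \<open>\<rho>\<close> the ordered pairs \<open>(i, partner i)\<close> with \<open>i \<le> 2 m\<close> are edges of the cycle whose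
  images under \<open>\<rho>\<close> are edges as well; there are \<open>2 m\<close> of them.\<close>

lemma avg_links_edge_sum:
  assumes "2 * m \<le> n"
  shows "(\<Sum>i\<in>{1..n}. \<Sum>j\<in>{1..n}. cyc n i j * avg_links n m i j) \<ge> 2 * real m"
proof -
  have lb: "(\<Sum>i\<in>{1..n}. \<Sum>j\<in>{1..n}. cyc n i j * cyc n (inv \<rho> (inv \<sigma> i)) (inv \<rho> (inv \<sigma> j))) \<ge> 2 * real m"
    if \<sigma>: "\<sigma> \<in> auts n" and \<rho>: "\<rho> \<in> pairings n m" for \<sigma> \<rho>
  proof -
    have p: "\<sigma> \<in> perms n" "\<rho> \<in> perms n"
      using that auts_subset pairings_subset by blast+
    define \<tau> where "\<tau> = \<sigma> \<circ> \<rho>"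
    have \<tau>: "\<tau> \<in> perms n"
      using p comp_in_perms by (simp add: \<tau>_def)
    let ?f = "\<lambda>i j. cyc n i j * cyc n (inv \<rho> (inv \<sigma> i)) (inv \<rho> (inv \<sigma> j))"
    have f: "?f (\<tau> i) (\<tau> j) = cyc n (\<rho> i) (\<rho> j) * cyc n i j" for i j
      using auts_cyc[OF \<sigma>] perms_inverses[OF p(1)] perms_inverses[OF p(2)] by (simp add: \<tau>_def)
    have one: "1 \<le> (\<Sum>j\<in>{1..n}. cyc n (\<rho> i) (\<rho> j) * cyc n i j)" if i: "i \<in> {1..2*m}" for i
    proof -
      have q: "i \<in> {1..n}" "partner i \<in> {1..n}"
        using i assms partner_mem[of i "2*m"] by (auto simp: unpaired_def)
      then have r: "\<rho> i \<in> {1..n}" "\<rho> (partner i) \<in> {1..n}"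
        using perms_mem_iff[OF p(2)] by blast+
      have "\<rho> (partner i) \<noteq> \<rho> i"
        using perms_eq_iff[OF p(2)] q by (auto simp: partner_def split: if_splits)
      then have "\<rho> (partner i) = partner (\<rho> i)"
        using \<rho> i r block_eq_iff[of "\<rho> i" "\<rho> (partner i)"] by (auto simp: pairings_def)
      then have "cyc n (\<rho> i) (\<rho> (partner i)) * cyc n i (partner i) = 1"
        using partner_cyc[of "\<rho> i" n] partner_cyc[OF q] r by simp
      moreover have "cyc n (\<rho> i) (\<rho> (partner i)) * cyc n i (partner i) \<le>
          (\<Sum>j\<in>{1..n}. cyc n (\<rho> i) (\<rho> j) * cyc n i j)"
        using q by (intro member_le_sum) (auto intro: mult_nonneg_nonneg cyc_nonneg)
      ultimately show ?thesis by simp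
    qed
    have "2 * real m = (\<Sum>i\<in>{1..2*m}. 1)"
      by simp
    also have "\<dots> \<le> (\<Sum>i\<in>{1..2*m}. \<Sum>j\<in>{1..n}. cyc n (\<rho> i) (\<rho> j) * cyc n i j)"
      by (intro sum_mono one)
    also have "\<dots> \<le> (\<Sum>i\<in>{1..n}. \<Sum>j\<in>{1..n}. cyc n (\<rho> i) (\<rho> j) * cyc n i j)"
      using assms by (intro sum_mono2) (auto intro!: sum_nonneg mult_nonneg_nonneg cyc_nonneg)
    also have "\<dots> = (\<Sum>i\<in>{1..n}. \<Sum>j\<in>{1..n}. ?f (\<tau> i) (\<tau> j))"
      by (simp only: f)
    also have "\<dots> = (\<Sum>i\<in>{1..n}. \<Sum>j\<in>{1..n}. ?f i j)"
      unfolding sum_perms[OF \<tau>, of "\<lambda>j. ?f _ j"] 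
      by (rule sum_perms[OF \<tau>, of "\<lambda>i. \<Sum>j\<in>{1..n}. ?f i j"])
    finally show ?thesis .
  qed
  let ?W = "real (card (auts n)) * real (card (pairings n m))"
  have "?W * (2 * real m) = (\<Sum>\<sigma>\<in>auts n. \<Sum>\<rho>\<in>pairings n m. 2 * real m)"
    by simp
  also have "\<dots> \<le> (\<Sum>\<sigma>\<in>auts n. \<Sum>\<rho>\<in>pairings n m.
      \<Sum>i\<in>{1..n}. \<Sum>j\<in>{1..n}. cyc n i j * cyc n (inv \<rho> (inv \<sigma> i)) (inv \<rho> (inv \<sigma> j)))"
    by (intro sum_mono lb)
  also have "\<dots> = (\<Sum>i\<in>{1..n}. \<Sum>j\<in>{1..n}. \<Sum>\<sigma>\<in>auts n. \<Sum>\<rho>\<in>pairings n m.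
      cyc n i j * cyc n (inv \<rho> (inv \<sigma> i)) (inv \<rho> (inv \<sigma> j)))"
    by (simp only: sum.swap[of _ "{1..n}" "pairings n m"] sum.swap[of _ "{1..n}" "auts n"])
  also have "\<dots> = (\<Sum>i\<in>{1..n}. \<Sum>j\<in>{1..n}. ?W * (cyc n i j * avg_links n m i j))"
    using card_auts_pos[of n] card_pairings_pos[of n m]
    by (simp add: avg_links_def links_def flip: sum_distrib_left)
  also have "\<dots> = ?W * (\<Sum>i\<in>{1..n}. \<Sum>j\<in>{1..n}. cyc n i j * avg_links n m i j)"
    by (simp only: sum_distrib_left)
  finally show ?thesis
    using card_auts_pos[of n] card_pairings_pos[of n m] by simp
qed

text \<open>With \<open>A\<close> on edges and \<open>B\<close> on non-edges the coefficient is \<open>a = A - B\<close>.  Eliminating \<open>B\<close> from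
  \<open>2 A + (n - 3) B = 2\<close> gives \<open>(n - 3) a = (n - 1) A - 2\<close>, and \<open>A \<ge> m / n\<close> then yields the bound.\<close>

lemma avg_links_affine:
  assumes n: "4 \<le> n" and m: "3 \<le> m" "2 * m \<le> n"
  shows "\<exists>a b. (real m - 2) / real n \<le> a \<and>
    (\<forall>i\<in>{1..n}. \<forall>j\<in>{1..n}. avg_links n m i j = a * cyc n i j + b * of_bool (i \<noteq> j))"
proof -
  define A where "A = avg_links n m 1 (step n 1)"
  obtain B where B: "\<forall>i\<in>{1..n}. \<forall>j\<in>{1..n}. i \<noteq> j \<longrightarrow> cyc n i j = 0 \<longrightarrow> avg_links n m i j = B"
    using avg_links_nonadjacent[of n m] by (elim exE)
  have eq: "avg_links n m i j = (A - B) * cyc n i j + B * of_bool (i \<noteq> j)"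
    if "i \<in> {1..n}" "j \<in> {1..n}" for i j
    using cyc_cases[of n i j] avg_links_adjacent[of n i j m] B that n
      avg_links_refl[of n m i] cyc_refl[of n i] by (auto simp: A_def)
  have "2 = (\<Sum>j\<in>{1..n}. avg_links n m 1 j)"
    using avg_links_row_sum[of n 1 m] n by simp
  also have "\<dots> = (\<Sum>j\<in>{1..n}. (A - B) * cyc n 1 j + B * (1 - of_bool (j = 1)))"
    using n by (intro sum.cong refl) (auto simp: eq)
  also have "\<dots> = (A - B) * 2 + B * (real n - 1)"
    using cyc_row_sum[of n 1] n
    by (simp add: sum.distrib sum_subtractf right_diff_distrib flip: sum_distrib_left)
  finally have row: "2 * A + (real n - 3) * B = 2"
    by (simp add: algebra_simps)
  have "2 * real m \<le> (\<Sum>i\<in>{1..n}. \<Sum>j\<in>{1..n}. cyc n i j * avg_links n m i j)"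
    using avg_links_edge_sum m by blast
  also have "\<dots> = (\<Sum>i\<in>{1..n}. A * (\<Sum>j\<in>{1..n}. cyc n i j))"
  proof -
    have "cyc n i j * avg_links n m i j = A * cyc n i j" for i j
      using cyc_cases[of n i j] avg_links_adjacent[of n i j m] by (auto simp: A_def)
    then show ?thesis by (simp only: sum_distrib_left)
  qed
  also have "\<dots> = 2 * real n * A"
    using cyc_row_sum[of n] n by simp
  finally have edge: "real m \<le> real n * A"
    by simp
  \<comment> \<open>The difference of the two sides is \<open>2 m - 6\<close>, which is where \<open>m \<ge> 3\<close> enters.\<close>
  have "(real n - 3) * (real m - 2) \<le> (real n - 1) * real m - 2 * real n"
    using m by (simp add: algebra_simps)
  also have "\<dots> \<le> (real n - 1) * (real n * A) - 2 * real n"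
    using edge n by (simp add: mult_left_mono)
  also have "\<dots> = real n * ((real n - 3) * A - (2 - 2 * A))"
    by (simp add: algebra_simps)
  also have "\<dots> = (real n - 3) * (real n * (A - B))"
  proof -
    have "2 - 2 * A = (real n - 3) * B"
      using row by simp
    then show ?thesis
      by (simp add: right_diff_distrib mult.left_commute)
  qed
  finally have "real m - 2 \<le> real n * (A - B)"
    using n by simp
  then have "(real m - 2) / real n \<le> A - B"
    using n by (simp add: divide_simps mult.commute)
  then show ?thesis
    using eq by blast
qed

section \<open>Densities supported on cycles with prescribed edges\<close>

lemma lookup_scaleR: "Poly_Mapping.lookup (r *\<^sub>R f) x = r * Poly_Mapping.lookup f x"
  for f :: "'a \<Rightarrow>\<^sub>0 real"
proof -
  have "{x. r *\<^sub>R Poly_Mapping.lookup f x \<noteq> 0} \<subseteq> {x. Poly_Mapping.lookup f x \<noteq> 0}"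
    by auto
  then have "finite {x. r *\<^sub>R Poly_Mapping.lookup f x \<noteq> 0}"
    using finite_subset finite_lookup by blast
  then show ?thesis
    by (simp add: scaleR_poly_mapping_def)
qed

definition densities :: "nat \<Rightarrow> (matrix \<Rightarrow>\<^sub>0 real) set" where
  "densities n = {f \<in> function_space (ham_matrices n).
     (\<forall>x\<in>ham_matrices n. 0 \<le> Poly_Mapping.lookup f x) \<and>
     (\<Sum>x\<in>ham_matrices n. Poly_Mapping.lookup f x) = real (card (ham_matrices n))}"

text \<open>The density, relative to the uniform distribution on \<open>X\<close>, of the cycle \<open>M (\<tau> \<circ> \<rho>\<^sup>-\<^sup>1)\<close> for a uniformly
  random pairing \<open>\<rho>\<close>.\<close>

definition pairing_density :: "nat \<Rightarrow> nat \<Rightarrow> (nat \<Rightarrow> nat) \<Rightarrow> (matrix \<Rightarrow>\<^sub>0 real)" where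
  "pairing_density n m \<tau> = (\<Sum>\<rho>\<in>pairings n m. Poly_Mapping.single (relabel (\<tau> \<circ> inv \<rho>) (cyc n))
     (real (card (ham_matrices n)) / real (card (pairings n m))))"

definition pairing_polytope :: "nat \<Rightarrow> nat \<Rightarrow> (matrix \<Rightarrow>\<^sub>0 real) set" where
  "pairing_polytope n m = convex hull (pairing_density n m ` perms n)"

lemma function_space_iff:
  "f \<in> function_space X \<longleftrightarrow> (\<forall>x. x \<notin> X \<longrightarrow> Poly_Mapping.lookup f x = 0)"
  by (auto simp: function_space_def in_keys_iff)

lemma function_space_eqI:
  assumes "f \<in> function_space X" "g \<in> function_space X"
    and "\<And>x. x \<in> X \<Longrightarrow> Poly_Mapping.lookup f x = Poly_Mapping.lookup g x"
  shows "f = g"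
proof (rule poly_mapping_eqI)
  fix x
  show "Poly_Mapping.lookup f x = Poly_Mapping.lookup g x"
    using assms by (cases "x \<in> X") (auto simp: function_space_iff)
qed

lemma convex_densities: "convex (densities n)"
proof (rule convexI)
  fix f g :: "matrix \<Rightarrow>\<^sub>0 real" and u v :: real
  assume fg: "f \<in> densities n" "g \<in> densities n" and uv: "0 \<le> u" "0 \<le> v" "u + v = 1"
  have l: "Poly_Mapping.lookup (u *\<^sub>R f + v *\<^sub>R g) x =
      u * Poly_Mapping.lookup f x + v * Poly_Mapping.lookup g x" for x
    by (simp add: lookup_add lookup_scaleR)
  have "u * real (card (ham_matrices n)) + v * real (card (ham_matrices n)) = real (card (ham_matrices n))"
    using uv by (simp flip: distrib_right)
  then show "u *\<^sub>R f + v *\<^sub>R g \<in> densities n"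
    using fg uv unfolding densities_def mem_Collect_eq function_space_iff l
    by (simp add: sum.distrib flip: sum_distrib_left)
qed

lemma ham_matrices_nonempty:
  assumes "3 \<le> n"
  shows "0 < card (ham_matrices n)"
proof -
  have "ham_matrices n \<noteq> {}"
    using ham_matrices_eq[OF assms] id_in_perms[of n] by blast
  then show ?thesis
    using finite_ham_matrices by (simp add: card_gt_0_iff)
qed

lemma nonneg_mean_one_eq:
  assumes "3 \<le> n"
  shows "nonneg_mean_one n = densities n \<inter> linear_restrictions n"
  using ham_matrices_nonempty[OF assms]
  by (auto simp: nonneg_mean_one_def densities_def linear_restrictions_def divide_simps)

lemma relabel_in_ham_matrices:
  "3 \<le> n \<Longrightarrow> \<sigma> \<in> perms n \<Longrightarrow> relabel \<sigma> (cyc n) \<in> ham_matrices n"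
  using ham_matrices_eq by blast

lemma ham_matrixE:
  assumes "3 \<le> n" "x \<in> ham_matrices n"
  obtains \<pi> where "\<pi> \<in> perms n" "x = relabel \<pi> (cyc n)"
  using assms(2) unfolding ham_matrices_eq[OF assms(1)] by (elim imageE) (rule that)

lemma lookup_pairing_density:
  "Poly_Mapping.lookup (pairing_density n m \<tau>) x = (\<Sum>\<rho>\<in>pairings n m.
     if relabel (\<tau> \<circ> inv \<rho>) (cyc n) = x
     then real (card (ham_matrices n)) / real (card (pairings n m)) else 0)"
  by (simp add: pairing_density_def lookup_sum lookup_single when_def)

lemma pairing_density_in_densities:
  assumes n: "3 \<le> n" and \<tau>: "\<tau> \<in> perms n"
  shows "pairing_density n m \<tau> \<in> densities n"
proof -
  have mem: "relabel (\<tau> \<circ> inv \<rho>) (cyc n) \<in> ham_matrices n" if "\<rho> \<in> pairings n m" for \<rho>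
  proof -
    have "\<rho> \<in> perms n"
      using that pairings_subset by blast
    then show ?thesis
      by (intro relabel_in_ham_matrices n comp_in_perms \<tau> inv_in_perms)
  qed
  let ?w = "real (card (ham_matrices n)) / real (card (pairings n m))"
  have "(\<Sum>x\<in>ham_matrices n. Poly_Mapping.lookup (pairing_density n m \<tau>) x) =
      (\<Sum>\<rho>\<in>pairings n m. \<Sum>x\<in>ham_matrices n. if relabel (\<tau> \<circ> inv \<rho>) (cyc n) = x then ?w else 0)"
    unfolding lookup_pairing_density by (rule sum.swap)
  also have "\<dots> = (\<Sum>\<rho>\<in>pairings n m. ?w)"
    using mem by (intro sum.cong refl) (simp add: finite_ham_matrices)
  also have "\<dots> = real (card (ham_matrices n))"
    using card_pairings_pos[of n m] by simp
  finally show ?thesis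
    using mem by (auto simp: densities_def function_space_iff lookup_pairing_density
        intro!: sum_nonneg sum.neutral)
qed

text \<open>If \<open>\<tau>\<close> and \<open>\<tau>'\<close> agree on \<open>{1..2*m}\<close>, then \<open>\<tau>\<^sup>-\<^sup>1 \<circ> \<tau>'\<close> fixes these points, and composing with it on the
  right maps pairings to pairings.\<close>

lemma pairing_density_cong:
  assumes \<tau>: "\<tau> \<in> perms n" "\<tau>' \<in> perms n"
    and eq: "\<And>i. i \<in> {1..2*m} \<Longrightarrow> \<tau> i = \<tau>' i"
  shows "pairing_density n m \<tau> = pairing_density n m \<tau>'"
proof -
  have step: "\<rho> \<circ> (inv \<alpha> \<circ> \<beta>) \<in> pairings n m"
    if \<rho>: "\<rho> \<in> pairings n m" and p: "\<alpha> \<in> perms n" "\<beta> \<in> perms n"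
      and e: "\<And>i. i \<in> {1..2*m} \<Longrightarrow> \<alpha> i = \<beta> i" for \<rho> \<alpha> \<beta>
  proof -
    have fixed: "(inv \<alpha> \<circ> \<beta>) i = i" if "i \<in> {1..2*m}" for i
      using e[OF that] perms_inverses(2)[OF p(1), of i] by simp
    have "partner i \<in> {1..2*m}" if "i \<in> {1..2*m}" for i
      using partner_mem[OF that] by (simp add: unpaired_def)
    then show ?thesis
      using \<rho> fixed comp_in_perms[OF _ comp_in_perms[OF inv_in_perms[OF p(1)] p(2)], of \<rho>]
      by (auto simp: pairings_def)
  qed
  \<comment> \<open>The shift \<open>inv \<tau> \<circ> \<tau>'\<close> is chosen such that \<open>\<tau>' \<circ> inv (\<rho> \<circ> (inv \<tau> \<circ> \<tau>')) = \<tau> \<circ> inv \<rho>\<close>.\<close>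
  show ?thesis
    unfolding pairing_density_def
  proof (rule sum.reindex_bij_witness[of _ "\<lambda>\<rho>. \<rho> \<circ> (inv \<tau>' \<circ> \<tau>)" "\<lambda>\<rho>. \<rho> \<circ> (inv \<tau> \<circ> \<tau>')"])
    fix \<rho> assume \<rho>: "\<rho> \<in> pairings n m"
    then have \<rho>': "\<rho> \<in> perms n"
      using pairings_subset by blast
    show "\<rho> \<circ> (inv \<tau>' \<circ> \<tau>) \<in> pairings n m" "\<rho> \<circ> (inv \<tau> \<circ> \<tau>') \<in> pairings n m"
      using step[OF \<rho>] \<tau> eq by simp_all
    show "\<rho> \<circ> (inv \<tau> \<circ> \<tau>') \<circ> (inv \<tau>' \<circ> \<tau>) = \<rho>" "\<rho> \<circ> (inv \<tau>' \<circ> \<tau>) \<circ> (inv \<tau> \<circ> \<tau>') = \<rho>"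
      using perms_inverses(1,2)[OF \<tau>(1)] perms_inverses(1,2)[OF \<tau>(2)] by (simp_all add: fun_eq_iff)
    have "inv (\<rho> \<circ> (inv \<tau> \<circ> \<tau>')) = inv \<tau>' \<circ> \<tau> \<circ> inv \<rho>"
      using inv_comp_perms[OF \<rho>' comp_in_perms[OF inv_in_perms[OF \<tau>(1)] \<tau>(2)]]
        inv_comp_perms[OF inv_in_perms[OF \<tau>(1)] \<tau>(2)] perms_inverses(3)[OF \<tau>(1)]
      by (simp add: o_assoc)
    then have "\<tau>' \<circ> inv (\<rho> \<circ> (inv \<tau> \<circ> \<tau>')) = \<tau> \<circ> inv \<rho>"
      using perms_inverses(1)[OF \<tau>(2)] by (simp add: fun_eq_iff)
    then show "Poly_Mapping.single (relabel (\<tau>' \<circ> inv (\<rho> \<circ> (inv \<tau> \<circ> \<tau>'))) (cyc n))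
          (real (card (ham_matrices n)) / real (card (pairings n m))) =
        Poly_Mapping.single (relabel (\<tau> \<circ> inv \<rho>) (cyc n))
          (real (card (ham_matrices n)) / real (card (pairings n m)))"
      by (simp only:)
  qed
qed

lemma card_pairing_densities:
  assumes m: "2 * m \<le> n"
  shows "card (pairing_density n m ` perms n) \<le> n ^ (2 * m)"
proof -
  let ?r = "\<lambda>\<tau>. restrict \<tau> {1..2*m}"
  define F where "F g = pairing_density n m (SOME \<tau>. \<tau> \<in> perms n \<and> ?r \<tau> = g)" for g
  have "pairing_density n m \<tau> = F (?r \<tau>)" if \<tau>: "\<tau> \<in> perms n" for \<tau>
  proof -
    define \<tau>' where "\<tau>' = (SOME \<tau>'. \<tau>' \<in> perms n \<and> ?r \<tau>' = ?r \<tau>)"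
    have "\<tau>' \<in> perms n \<and> ?r \<tau>' = ?r \<tau>"
      unfolding \<tau>'_def by (rule someI[of _ \<tau>]) (simp add: \<tau>[simplified])
    then have \<tau>': "\<tau>' \<in> perms n" "?r \<tau>' = ?r \<tau>"
      by blast+
    have "\<tau> i = \<tau>' i" if "i \<in> {1..2*m}" for i
      using fun_cong[OF \<tau>'(2), of i] that by (simp only: restrict_apply if_True)
    then have "pairing_density n m \<tau> = pairing_density n m \<tau>'"
      using \<tau> \<tau>'(1) by (intro pairing_density_cong)
    then show ?thesis
      by (simp add: F_def \<tau>'_def)
  qed
  then have "pairing_density n m ` perms n = F ` ?r ` perms n"
    unfolding image_image by (rule image_cong[OF refl])
  also have "card \<dots> \<le> card (?r ` perms n)"
    by (intro card_image_le finite_imageI finite_perms)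
  also have "\<dots> \<le> card ({1..2*m} \<rightarrow>\<^sub>E {1..n})"
  proof (rule card_mono)
    show "?r ` perms n \<subseteq> {1..2*m} \<rightarrow>\<^sub>E {1..n}"
  proof
    fix g assume "g \<in> ?r ` perms n"
    then obtain \<tau> where \<tau>: "\<tau> \<in> perms n" and g: "g = ?r \<tau>" by blast
    have "\<tau> i \<in> {1..n}" if "i \<in> {1..2*m}" for i
      using perms_mem_iff[OF \<tau>, of i] that m by simp
    then show "g \<in> {1..2*m} \<rightarrow>\<^sub>E {1..n}"
      unfolding g by (intro restrict_PiE_iff[THEN iffD2]) blast
  qed
    show "finite ({1..2*m} \<rightarrow>\<^sub>E {1..n})"
      by (simp add: finite_PiE)
  qed
  also have "\<dots> = n ^ (2 * m)"
    by (simp add: card_funcsetE)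
  finally show ?thesis .
qed

text \<open>Each Hamiltonian cycle is \<open>M \<tau>\<close> for equally many \<open>\<tau>\<close>, since the fibre over \<open>M \<pi>\<close> is the coset of the
  automorphism group through \<open>\<pi>\<close>.  Hence averages over \<open>X\<close> and over permutations coincide.\<close>

lemma sum_relabel:
  assumes n: "3 \<le> n"
  shows "(\<Sum>\<tau>\<in>perms n. h (relabel \<tau> (cyc n))) = real (card (auts n)) * (\<Sum>x\<in>ham_matrices n. h x)"
proof -
  let ?M = "\<lambda>\<tau>. relabel \<tau> (cyc n)"
  have fib: "card {\<tau> \<in> perms n. ?M \<tau> = x} = card (auts n)" if xX: "x \<in> ham_matrices n" for x
  proof -
    obtain \<pi> where \<pi>: "\<pi> \<in> perms n" and x: "x = ?M \<pi>"
      by (rule ham_matrixE[OF n xX])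
    have "bij_betw (\<lambda>\<sigma>. \<pi> \<circ> \<sigma>) (auts n) {\<tau> \<in> perms n. ?M \<tau> = x}"
    proof (rule bij_betw_byWitness[where f' = "\<lambda>\<tau>. inv \<pi> \<circ> \<tau>"])
      show "\<forall>\<sigma>\<in>auts n. inv \<pi> \<circ> (\<pi> \<circ> \<sigma>) = \<sigma>" "\<forall>\<tau>\<in>{\<tau> \<in> perms n. ?M \<tau> = x}. \<pi> \<circ> (inv \<pi> \<circ> \<tau>) = \<tau>"
        using perms_inverses(1,2)[OF \<pi>] by (simp_all add: fun_eq_iff)
      show "(\<lambda>\<sigma>. \<pi> \<circ> \<sigma>) ` auts n \<subseteq> {\<tau> \<in> perms n. ?M \<tau> = x}"
      proof
        fix \<tau> assume "\<tau> \<in> (\<lambda>\<sigma>. \<pi> \<circ> \<sigma>) ` auts n"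
        then obtain \<sigma> where \<sigma>: "\<sigma> \<in> perms n" "relabel \<sigma> (cyc n) = cyc n" "\<tau> = \<pi> \<circ> \<sigma>"
          unfolding auts_def by blast
        then show "\<tau> \<in> {\<tau> \<in> perms n. ?M \<tau> = x}"
          using comp_in_perms[OF \<pi> \<sigma>(1)] relabel_comp[OF \<pi> \<sigma>(1), of "cyc n"] x by simp
      qed
      show "(\<lambda>\<tau>. inv \<pi> \<circ> \<tau>) ` {\<tau> \<in> perms n. ?M \<tau> = x} \<subseteq> auts n"
      proof
        fix \<sigma> assume "\<sigma> \<in> (\<lambda>\<tau>. inv \<pi> \<circ> \<tau>) ` {\<tau> \<in> perms n. ?M \<tau> = x}"
        then obtain \<tau> where \<tau>: "\<tau> \<in> perms n" "?M \<tau> = x" and \<sigma>: "\<sigma> = inv \<pi> \<circ> \<tau>"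
          by blast
        have \<sigma>': "\<sigma> \<in> perms n"
          unfolding \<sigma> using comp_in_perms[OF inv_in_perms[OF \<pi>] \<tau>(1)] .
        have "\<pi> \<circ> \<sigma> = \<tau>"
          using perms_inverses(1)[OF \<pi>] by (simp add: fun_eq_iff \<sigma>)
        then have "relabel \<pi> (?M \<sigma>) = relabel \<pi> (cyc n)"
          using relabel_comp[OF \<pi> \<sigma>', of "cyc n"] \<tau>(2) x by simp
        then show "\<sigma> \<in> auts n"
          using relabel_inject[OF \<pi>] \<sigma>' by (simp add: auts_def)
      qed
    qed
    then show ?thesis
      by (simp add: bij_betw_same_card)
  qed
  have "(\<Sum>\<tau>\<in>perms n. h (?M \<tau>)) = (\<Sum>x\<in>ham_matrices n. \<Sum>\<tau>\<in>{\<tau> \<in> perms n. ?M \<tau> = x}. h (?M \<tau>))"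
    using ham_matrices_eq[OF n] by (intro sum.group[symmetric] finite_perms finite_ham_matrices) auto
  also have "\<dots> = (\<Sum>x\<in>ham_matrices n. real (card (auts n)) * h x)"
    using fib by (intro sum.cong refl) simp
  finally show ?thesis
    by (simp only: sum_distrib_left)
qed

section \<open>Smoothing linear functions\<close>

text \<open>A Hamiltonian cycle has \<open>2 n\<close> ordered pairs of adjacent vertices, so \<open>\<one>\<close> is the restriction of the
  linear function with all coefficients \<open>1 / (2 n)\<close>.\<close>

lemma const_one_in_nonneg_mean_one:
  assumes n: "3 \<le> n"
  shows "const_one (ham_matrices n) \<in> nonneg_mean_one n"
proof -
  let ?X = "ham_matrices n"
  have lk: "Poly_Mapping.lookup (const_one ?X) x = (if x \<in> ?X then 1 else 0)" for x
    by (rule lookup_const_one[OF finite_ham_matrices])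
  have "matrix_inner n (\<lambda>_ _. 1 / (2 * real n)) x = 1" if xX: "x \<in> ?X" for x
  proof -
    obtain \<pi> where \<pi>: "\<pi> \<in> perms n" and x: "x = relabel \<pi> (cyc n)"
      by (rule ham_matrixE[OF n xX])
    note ip = sum_perms[OF inv_in_perms[OF \<pi>]]
    have "(\<Sum>i\<in>{1..n}. \<Sum>j\<in>{1..n}. x i j) = (\<Sum>i\<in>{1..n}. \<Sum>j\<in>{1..n}. cyc n (inv \<pi> i) j)"
      unfolding x relabel_def by (intro sum.cong refl ip)
    also have "\<dots> = (\<Sum>i\<in>{1..n}. \<Sum>j\<in>{1..n}. cyc n i j)"
      by (rule ip)
    also have "\<dots> = 2 * real n"
      using cyc_row_sum[OF n] by simp
    finally show ?thesis
      using n by (simp add: matrix_inner_def flip: sum_divide_distrib)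
  qed
  then have "const_one ?X \<in> linear_restrictions n"
    unfolding linear_restrictions_def function_space_iff mem_Collect_eq lk by fastforce
  moreover have "const_one ?X \<in> densities n"
    by (simp add: densities_def function_space_iff lk)
  ultimately show ?thesis
    using nonneg_mean_one_eq[OF n] by blast
qed

text \<open>The space \<open>L\<close> contains \<open>\<one>\<close> and is closed under linear combinations.\<close>

lemma linear_restrictions_shift:
  assumes n: "3 \<le> n" and f: "f \<in> linear_restrictions n"
  shows "const_one (ham_matrices n) + r *\<^sub>R (f - const_one (ham_matrices n)) \<in> linear_restrictions n"
proof -
  let ?X = "ham_matrices n" and ?e = "const_one (ham_matrices n)"
  have e: "?e \<in> linear_restrictions n"
    using const_one_in_nonneg_mean_one[OF n] by (simp add: nonneg_mean_one_def)
  obtain c where c: "\<forall>x\<in>?X. Poly_Mapping.lookup f x = matrix_inner n c x"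
    using f unfolding linear_restrictions_def by blast
  obtain d where d: "\<forall>x\<in>?X. Poly_Mapping.lookup ?e x = matrix_inner n d x"
    using e unfolding linear_restrictions_def by blast
  have lk: "Poly_Mapping.lookup (?e + r *\<^sub>R (f - ?e)) x =
      Poly_Mapping.lookup ?e x + r * (Poly_Mapping.lookup f x - Poly_Mapping.lookup ?e x)" for x
    by (simp add: lookup_add lookup_minus lookup_scaleR)
  have "matrix_inner n (\<lambda>i j. d i j + r * (c i j - d i j)) x =
      matrix_inner n d x + r * (matrix_inner n c x - matrix_inner n d x)" for x
    unfolding matrix_inner_def
    by (simp add: algebra_simps sum.distrib sum_subtractf sum_distrib_left)
  then have "\<forall>x\<in>?X. Poly_Mapping.lookup (?e + r *\<^sub>R (f - ?e)) x =
      matrix_inner n (\<lambda>i j. d i j + r * (c i j - d i j)) x"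
    using c d by (simp add: lk)
  moreover have "?e + r *\<^sub>R (f - ?e) \<in> function_space ?X"
    using e f by (simp add: linear_restrictions_def function_space_iff lk)
  ultimately show ?thesis
    unfolding linear_restrictions_def by blast
qed

lemma sum_perms_conjugate:
  assumes "\<pi> \<in> perms n" "\<rho> \<in> perms n"
  shows "(\<Sum>\<tau>\<in>perms n. F \<tau>) = (\<Sum>\<sigma>\<in>perms n. F (\<pi> \<circ> \<sigma> \<circ> \<rho>))"
  using assms sum_permutations_compose_right[of \<rho> "{1..n}" F]
    setum_permutations_compose_left[of \<pi> "{1..n}" "\<lambda>\<tau>. F (\<tau> \<circ> \<rho>)"] by simp

text \<open>The two descriptions of the smoothing operator agree: substitute \<open>\<tau> = \<pi> \<circ> \<sigma> \<circ> \<rho>\<close> in the mixture of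
  densities, and observe that \<open>M (\<pi> \<circ> \<sigma>) = M \<pi>\<close> exactly if \<open>\<sigma>\<close> is an automorphism of the standard
  cycle.\<close>

lemma lookup_average:
  assumes n: "3 \<le> n" and \<pi>: "\<pi> \<in> perms n"
  shows "Poly_Mapping.lookup (\<Sum>\<tau>\<in>perms n. (h (relabel \<tau> (cyc n)) / real (card (perms n))) *\<^sub>R
      pairing_density n m \<tau>) (relabel \<pi> (cyc n)) =
    (\<Sum>\<sigma>\<in>auts n. \<Sum>\<rho>\<in>pairings n m. h (relabel (\<pi> \<circ> \<sigma> \<circ> \<rho>) (cyc n))) /
      (real (card (auts n)) * real (card (pairings n m)))"
proof -
  let ?M = "\<lambda>\<tau>. relabel \<tau> (cyc n)" and ?N = "real (card (perms n))" and ?X = "ham_matrices n"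
  define w where "w = real (card ?X) / real (card (pairings n m))"
  have N: "?N = real (card (auts n)) * real (card ?X)"
    using sum_relabel[OF n, of "\<lambda>_. 1"] by simp
  have w: "w / ?N = 1 / (real (card (auts n)) * real (card (pairings n m)))"
    using ham_matrices_nonempty[OF n] unfolding N w_def by simp
  have inner: "(\<Sum>\<tau>\<in>perms n. if ?M (\<tau> \<circ> inv \<rho>) = ?M \<pi> then h (?M \<tau>) * (w / ?N) else 0) =
      (\<Sum>\<sigma>\<in>auts n. h (?M (\<pi> \<circ> \<sigma> \<circ> \<rho>)) * (w / ?N))" if \<rho>: "\<rho> \<in> pairings n m" for \<rho>
  proof -
    have \<rho>': "\<rho> \<in> perms n"
      using \<rho> pairings_subset by blast
    have iff: "?M (\<pi> \<circ> \<sigma> \<circ> \<rho> \<circ> inv \<rho>) = ?M \<pi> \<longleftrightarrow> \<sigma> \<in> auts n" if \<sigma>: "\<sigma> \<in> perms n" for \<sigma>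
    proof -
      have "\<pi> \<circ> \<sigma> \<circ> \<rho> \<circ> inv \<rho> = \<pi> \<circ> \<sigma>"
        using perms_inverses(1)[OF \<rho>'] by (simp add: fun_eq_iff)
      then show ?thesis
        using relabel_comp[OF \<pi> \<sigma>, of "cyc n"] relabel_inject[OF \<pi>] \<sigma> by (simp add: auts_def)
    qed
    have "(\<Sum>\<tau>\<in>perms n. if ?M (\<tau> \<circ> inv \<rho>) = ?M \<pi> then h (?M \<tau>) * (w / ?N) else 0) =
        (\<Sum>\<sigma>\<in>perms n. if ?M (\<pi> \<circ> \<sigma> \<circ> \<rho> \<circ> inv \<rho>) = ?M \<pi> then h (?M (\<pi> \<circ> \<sigma> \<circ> \<rho>)) * (w / ?N) else 0)"
      by (rule sum_perms_conjugate[OF \<pi> \<rho>'])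
    also have "\<dots> = (\<Sum>\<sigma>\<in>perms n. if \<sigma> \<in> auts n then h (?M (\<pi> \<circ> \<sigma> \<circ> \<rho>)) * (w / ?N) else 0)"
      by (intro sum.cong refl) (simp only: iff)
    also have "\<dots> = (\<Sum>\<sigma>\<in>auts n. h (?M (\<pi> \<circ> \<sigma> \<circ> \<rho>)) * (w / ?N))"
      using auts_subset[of n] finite_perms[of n] by (simp add: sum.If_cases Int_absorb1 flip: Int_def)
    finally show ?thesis .
  qed
  have "Poly_Mapping.lookup (\<Sum>\<tau>\<in>perms n. (h (?M \<tau>) / ?N) *\<^sub>R pairing_density n m \<tau>) (?M \<pi>) =
      (\<Sum>\<tau>\<in>perms n. \<Sum>\<rho>\<in>pairings n m. if ?M (\<tau> \<circ> inv \<rho>) = ?M \<pi> then h (?M \<tau>) * (w / ?N) else 0)"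
    unfolding lookup_sum lookup_scaleR lookup_pairing_density sum_distrib_left
    by (intro sum.cong refl) (simp add: w_def)
  also have "\<dots> = (\<Sum>\<rho>\<in>pairings n m. \<Sum>\<tau>\<in>perms n. if ?M (\<tau> \<circ> inv \<rho>) = ?M \<pi> then h (?M \<tau>) * (w / ?N) else 0)"
    by (rule sum.swap)
  also have "\<dots> = (\<Sum>\<rho>\<in>pairings n m. \<Sum>\<sigma>\<in>auts n. h (?M (\<pi> \<circ> \<sigma> \<circ> \<rho>)) * (w / ?N))"
    using inner by (rule sum.cong[OF refl])
  also have "\<dots> = (\<Sum>\<sigma>\<in>auts n. \<Sum>\<rho>\<in>pairings n m. h (?M (\<pi> \<circ> \<sigma> \<circ> \<rho>)) * (w / ?N))"
    by (rule sum.swap)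
  finally show ?thesis
    unfolding w by (simp flip: sum_divide_distrib)
qed

lemma sum_matrix_inner_relabel:
  assumes \<pi>: "\<pi> \<in> perms n"
  shows "(\<Sum>\<sigma>\<in>auts n. \<Sum>\<rho>\<in>pairings n m. matrix_inner n c (relabel (\<pi> \<circ> \<sigma> \<circ> \<rho>) (cyc n))) /
      (real (card (auts n)) * real (card (pairings n m))) =
    (\<Sum>i\<in>{1..n}. \<Sum>j\<in>{1..n}. c i j * avg_links n m (inv \<pi> i) (inv \<pi> j))"
proof -
  have "relabel (\<pi> \<circ> \<sigma> \<circ> \<rho>) (cyc n) i j = cyc n (inv \<rho> (inv \<sigma> (inv \<pi> i))) (inv \<rho> (inv \<sigma> (inv \<pi> j)))"
    if "\<sigma> \<in> auts n" "\<rho> \<in> pairings n m" for \<sigma> \<rho> i j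
  proof -
    have p: "\<sigma> \<in> perms n" "\<rho> \<in> perms n"
      using that auts_subset pairings_subset by blast+
    show ?thesis
      using inv_comp_perms[OF comp_in_perms[OF \<pi> p(1)] p(2)] inv_comp_perms[OF \<pi> p(1)]
      by (simp add: relabel_def)
  qed
  then have "(\<Sum>\<sigma>\<in>auts n. \<Sum>\<rho>\<in>pairings n m. matrix_inner n c (relabel (\<pi> \<circ> \<sigma> \<circ> \<rho>) (cyc n))) =
      (\<Sum>\<sigma>\<in>auts n. \<Sum>\<rho>\<in>pairings n m. \<Sum>i\<in>{1..n}. \<Sum>j\<in>{1..n}.
        c i j * cyc n (inv \<rho> (inv \<sigma> (inv \<pi> i))) (inv \<rho> (inv \<sigma> (inv \<pi> j))))"
    unfolding matrix_inner_def by (intro sum.cong refl) simp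
  also have "\<dots> = (\<Sum>i\<in>{1..n}. \<Sum>j\<in>{1..n}. \<Sum>\<sigma>\<in>auts n. \<Sum>\<rho>\<in>pairings n m.
        c i j * cyc n (inv \<rho> (inv \<sigma> (inv \<pi> i))) (inv \<rho> (inv \<sigma> (inv \<pi> j))))"
    by (simp only: sum.swap[of _ "{1..n}" "pairings n m"] sum.swap[of _ "{1..n}" "auts n"])
  finally show ?thesis
    by (simp add: avg_links_def links_def sum_divide_distrib sum_distrib_left)
qed

text \<open>The smoothing \<open>g\<close> of \<open>f\<close> lies in the polytope because \<open>f \<in> Q\<close> makes its weights a probability
  distribution.  By \<open>avg_links_affine\<close> it equals \<open>a f + K\<close>, and comparing means forces \<open>K = 1 - a\<close>.\<close>

lemma pairing_polytope_contains:
  assumes n: "4 \<le> n" and m: "3 \<le> m" "2 * m \<le> n"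
  shows "\<exists>a. (real m - 2) / real n \<le> a \<and> (\<forall>f\<in>nonneg_mean_one n.
    const_one (ham_matrices n) + a *\<^sub>R (f - const_one (ham_matrices n)) \<in> pairing_polytope n m)"
proof -
  let ?X = "ham_matrices n" and ?M = "\<lambda>\<tau>. relabel \<tau> (cyc n)" and ?N = "real (card (perms n))"
  have n3: "3 \<le> n"
    using n by simp
  obtain a b where a: "(real m - 2) / real n \<le> a"
    and avg: "\<forall>i\<in>{1..n}. \<forall>j\<in>{1..n}. avg_links n m i j = a * cyc n i j + b * of_bool (i \<noteq> j)"
    using avg_links_affine[OF assms] by blast
  have "const_one ?X + a *\<^sub>R (f - const_one ?X) \<in> pairing_polytope n m"
    if "f \<in> nonneg_mean_one n" for f
  proof -
    have fd: "f \<in> densities n" and fL: "f \<in> linear_restrictions n"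
      using that nonneg_mean_one_eq[OF n3] by auto
    obtain c where c: "\<forall>x\<in>?X. Poly_Mapping.lookup f x = matrix_inner n c x"
      using fL unfolding linear_restrictions_def by blast
    define K where "K = b * (\<Sum>i\<in>{1..n}. \<Sum>j\<in>{1..n}. c i j * of_bool (i \<noteq> j))"
    define g where "g = (\<Sum>\<tau>\<in>perms n. (Poly_Mapping.lookup f (?M \<tau>) / ?N) *\<^sub>R pairing_density n m \<tau>)"
    have N: "?N = real (card (auts n)) * real (card ?X)"
      using sum_relabel[OF n3, of "\<lambda>_. 1"] by simp
    have N0: "?N \<noteq> 0"
      using card_auts_pos[of n] ham_matrices_nonempty[OF n3] unfolding N by simp
    have weights: "(\<Sum>\<tau>\<in>perms n. Poly_Mapping.lookup f (?M \<tau>) / ?N) = 1"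
      using sum_relabel[OF n3, of "Poly_Mapping.lookup f"] fd N N0
      by (simp add: densities_def flip: sum_divide_distrib)
    have pos: "0 \<le> Poly_Mapping.lookup f (?M \<tau>) / ?N" if "\<tau> \<in> perms n" for \<tau>
      using fd relabel_in_ham_matrices[OF n3 that] by (simp add: densities_def)
    have gP: "g \<in> pairing_polytope n m"
      unfolding g_def pairing_polytope_def
      by (intro convex_sum finite_perms convex_convex_hull weights pos) (auto intro: hull_inc)
    have gd: "g \<in> densities n"
      unfolding g_def
      by (intro convex_sum finite_perms convex_densities weights pos pairing_density_in_densities n3)
    have lg: "Poly_Mapping.lookup g x = a * Poly_Mapping.lookup f x + K" if x: "x \<in> ?X" for x
    proof -
      obtain \<pi> where \<pi>: "\<pi> \<in> perms n" and x\<pi>: "x = ?M \<pi>"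
        by (rule ham_matrixE[OF n3 x])
      have fM: "Poly_Mapping.lookup f (?M (\<pi> \<circ> \<sigma> \<circ> \<rho>)) = matrix_inner n c (?M (\<pi> \<circ> \<sigma> \<circ> \<rho>))"
        if "\<sigma> \<in> auts n" "\<rho> \<in> pairings n m" for \<sigma> \<rho>
      proof -
        have "\<sigma> \<in> perms n" "\<rho> \<in> perms n"
          using that auts_subset pairings_subset by blast+
        then have "?M (\<pi> \<circ> \<sigma> \<circ> \<rho>) \<in> ?X"
          by (intro relabel_in_ham_matrices[OF n3] comp_in_perms \<pi>)
        then show ?thesis
          using c by blast
      qed
      have "Poly_Mapping.lookup g x =
          (\<Sum>\<sigma>\<in>auts n. \<Sum>\<rho>\<in>pairings n m. matrix_inner n c (?M (\<pi> \<circ> \<sigma> \<circ> \<rho>))) /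
            (real (card (auts n)) * real (card (pairings n m)))"
        unfolding g_def x\<pi> lookup_average[OF n3 \<pi>, of "Poly_Mapping.lookup f"]
        using fM by (intro arg_cong2[where f = "(/)"] sum.cong refl)
      also have "\<dots> = (\<Sum>i\<in>{1..n}. \<Sum>j\<in>{1..n}. c i j * avg_links n m (inv \<pi> i) (inv \<pi> j))"
        by (rule sum_matrix_inner_relabel[OF \<pi>])
      also have "\<dots> = (\<Sum>i\<in>{1..n}. \<Sum>j\<in>{1..n}. a * (c i j * x i j) + b * (c i j * of_bool (i \<noteq> j)))"
      proof (intro sum.cong refl)
        fix i j assume ij: "i \<in> {1..n}" "j \<in> {1..n}"
        have "inv \<pi> i \<in> {1..n}" "inv \<pi> j \<in> {1..n}"
          using ij inv_perms_mem_iff[OF \<pi>] by blast+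
        then have "avg_links n m (inv \<pi> i) (inv \<pi> j) = a * x i j + b * of_bool (i \<noteq> j)"
          using avg perms_eq_iff[OF inv_in_perms[OF \<pi>]] by (simp add: x\<pi> relabel_def)
        then show "c i j * avg_links n m (inv \<pi> i) (inv \<pi> j) = a * (c i j * x i j) + b * (c i j * of_bool (i \<noteq> j))"
          by (simp add: algebra_simps)
      qed
      also have "\<dots> = a * matrix_inner n c x + K"
        by (simp only: K_def matrix_inner_def sum.distrib sum_distrib_left)
      finally show ?thesis
        using c x by simp
    qed
    have "real (card ?X) = (\<Sum>x\<in>?X. a * Poly_Mapping.lookup f x + K)"
      using gd lg by (simp add: densities_def)
    also have "\<dots> = a * real (card ?X) + K * real (card ?X)"
      using fd by (simp add: densities_def sum.distrib flip: sum_distrib_left)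
    finally have "real (card ?X) * (1 - a - K) = 0"
      by (simp add: algebra_simps)
    then have K: "K = 1 - a"
      using ham_matrices_nonempty[OF n3] by simp
    have "const_one ?X + a *\<^sub>R (f - const_one ?X) = g"
    proof (rule function_space_eqI[of _ ?X])
      have "const_one ?X + a *\<^sub>R (f - const_one ?X) \<in> linear_restrictions n"
        by (rule linear_restrictions_shift[OF n3 fL])
      then show "const_one ?X + a *\<^sub>R (f - const_one ?X) \<in> function_space ?X"
        by (simp add: linear_restrictions_def)
      show "g \<in> function_space ?X"
        using gd by (simp add: densities_def)
      fix x assume x: "x \<in> ?X"
      then have "Poly_Mapping.lookup (const_one ?X) x = 1"
        by (simp add: lookup_const_one finite_ham_matrices)
      then show "Poly_Mapping.lookup (const_one ?X + a *\<^sub>R (f - const_one ?X)) x = Poly_Mapping.lookup g x"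
        unfolding lg[OF x] K by (simp add: lookup_add lookup_minus lookup_scaleR algebra_simps)
    qed
    then show ?thesis
      using gP by simp
  qed
  then show ?thesis
    using a by blast
qed

lemma pairing_polytope_subset_densities:
  assumes "3 \<le> n"
  shows "pairing_polytope n m \<subseteq> densities n"
  unfolding pairing_polytope_def
  using pairing_density_in_densities[OF assms] by (intro hull_minimal convex_densities) blast

lemma card_extreme_points_pairing_polytope:
  assumes "2 * m \<le> n"
  shows "card {v. v extreme_point_of pairing_polytope n m} \<le> n ^ (2 * m)"
proof -
  have "{v. v extreme_point_of pairing_polytope n m} \<subseteq> pairing_density n m ` perms n"
    using extreme_point_of_convex_hull unfolding pairing_polytope_def by blast
  then have "card {v. v extreme_point_of pairing_polytope n m} \<le> card (pairing_density n m ` perms n)"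
    by (intro card_mono finite_imageI finite_perms)
  also have "\<dots> \<le> n ^ (2 * m)"
    by (rule card_pairing_densities[OF assms])
  finally show ?thesis .
qed

theorem theorem1p1:
  shows "\<exists>C1 C2 :: real. C1 > 0 \<and> C2 > 0 \<and>
    (\<forall>n k :: nat. 4 \<le> n \<longrightarrow> 1 \<le> k \<longrightarrow> real k \<le> real n powr (1 / 3) \<longrightarrow>
      (\<exists>(P :: (matrix \<Rightarrow>\<^sub>0 real) set) (c :: real).
         P \<subseteq> function_space (ham_matrices n) \<and>
         polytope P \<and>
         real (card {v. v extreme_point_of P}) \<le> C1 * real n ^ (4 * k) \<and>
         \<bar>c - real k / real n\<bar> \<le> C2 / real n \<and>
         (\<lambda>f. c *\<^sub>R (f - const_one (ham_matrices n))) ` nonneg_mean_one n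
           \<subseteq> (\<lambda>f. f - const_one (ham_matrices n)) ` (P \<inter> linear_restrictions n) \<and>
         (\<lambda>f. f - const_one (ham_matrices n)) ` (P \<inter> linear_restrictions n)
           \<subseteq> (\<lambda>f. f - const_one (ham_matrices n)) ` nonneg_mean_one n))"
proof (rule exI[of _ 1], rule exI[of _ 2], intro conjI allI impI)
  fix n k :: nat
  assume n: "4 \<le> n" and k: "1 \<le> k" and kn: "real k \<le> real n powr (1 / 3)"
  let ?X = "ham_matrices n"
  let ?e = "const_one ?X"
  have n3: "3 \<le> n"
    using n by simp
  have eQ: "?e \<in> nonneg_mean_one n"
    by (rule const_one_in_nonneg_mean_one[OF n3])
  show "\<exists>(P :: (matrix \<Rightarrow>\<^sub>0 real) set) (c :: real). P \<subseteq> function_space ?X \<and> polytope P \<and>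
         real (card {v. v extreme_point_of P}) \<le> 1 * real n ^ (4 * k) \<and>
         \<bar>c - real k / real n\<bar> \<le> 2 / real n \<and>
         (\<lambda>f. c *\<^sub>R (f - ?e)) ` nonneg_mean_one n \<subseteq> (\<lambda>f. f - ?e) ` (P \<inter> linear_restrictions n) \<and>
         (\<lambda>f. f - ?e) ` (P \<inter> linear_restrictions n) \<subseteq> (\<lambda>f. f - ?e) ` nonneg_mean_one n"
  proof (cases "k \<le> 2")
    case True
    show ?thesis
    proof (rule exI[of _ "{?e}"], rule exI[of _ 0], intro conjI)
      have eL: "?e \<in> linear_restrictions n"
        using eQ by (simp add: nonneg_mean_one_def)
      then show "{?e} \<subseteq> function_space ?X"
        by (simp add: linear_restrictions_def)
      show "polytope {?e}"
        by (rule polytope_sing)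
      have "{v. v extreme_point_of {?e}} \<subseteq> {?e}"
        by (auto simp: extreme_point_of_def)
      then have "real (card {v. v extreme_point_of {?e}}) \<le> 1"
        using card_mono[of "{?e}"] by simp
      also have "1 \<le> real n ^ (4 * k)"
        using n by (intro one_le_power) simp
      finally show "real (card {v. v extreme_point_of {?e}}) \<le> 1 * real n ^ (4 * k)"
        by simp
      show "\<bar>0 - real k / real n\<bar> \<le> 2 / real n"
        using True by (simp add: divide_right_mono)
      show "(\<lambda>f. 0 *\<^sub>R (f - ?e)) ` nonneg_mean_one n \<subseteq> (\<lambda>f. f - ?e) ` ({?e} \<inter> linear_restrictions n)"
        using eL by auto
      show "(\<lambda>f. f - ?e) ` ({?e} \<inter> linear_restrictions n) \<subseteq> (\<lambda>f. f - ?e) ` nonneg_mean_one n"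
        using eQ by auto
    qed
  next
    case False
    then have k3: "3 \<le> k"
      by simp
    have "real k ^ 3 \<le> (real n powr (1 / 3)) ^ 3"
      using kn by (intro power_mono) simp_all
    also have "\<dots> = real n"
      using n by (simp add: powr_power)
    finally have "real (k ^ 3) \<le> real n"
      by simp
    then have "k ^ 3 \<le> n"
      by linarith
    moreover have "2 * k \<le> k ^ 3"
      using k3 mult_mono[of 2 "k * k" k k] mult_mono[of 2 k 1 k]
      by (simp add: power3_eq_cube)
    ultimately have kn2: "2 * k \<le> n"
      by linarith
    obtain a where a: "(real k - 2) / real n \<le> a"
      and PQ: "\<forall>f\<in>nonneg_mean_one n. ?e + a *\<^sub>R (f - ?e) \<in> pairing_polytope n k"
      using pairing_polytope_contains[OF n k3 kn2] by blast
    define c where "c = (real k - 2) / real n"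
    have c: "0 < c" "c \<le> a"
      using k3 n a by (simp_all add: c_def)
    show ?thesis
    proof (rule exI[of _ "pairing_polytope n k"], rule exI[of _ c], intro conjI)
      show "pairing_polytope n k \<subseteq> function_space ?X"
        using pairing_polytope_subset_densities[OF n3] by (auto simp: densities_def)
      show "polytope (pairing_polytope n k)"
        unfolding pairing_polytope_def polytope_def using finite_perms by blast
      have "card {v. v extreme_point_of pairing_polytope n k} \<le> n ^ (2 * k)"
        by (rule card_extreme_points_pairing_polytope[OF kn2])
      also have "\<dots> \<le> n ^ (4 * k)"
        using n by (intro power_increasing) simp_all
      finally show "real (card {v. v extreme_point_of pairing_polytope n k}) \<le> 1 * real n ^ (4 * k)"
        by (metis mult_1 of_nat_le_iff of_nat_power)
      have "c - real k / real n = - (2 / real n)"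
        by (simp add: c_def diff_divide_distrib)
      then show "\<bar>c - real k / real n\<bar> \<le> 2 / real n"
        by simp
      show "(\<lambda>f. f - ?e) ` (pairing_polytope n k \<inter> linear_restrictions n) \<subseteq> (\<lambda>f. f - ?e) ` nonneg_mean_one n"
        using pairing_polytope_subset_densities[OF n3] nonneg_mean_one_eq[OF n3]
        by (intro image_mono) blast
      show "(\<lambda>f. c *\<^sub>R (f - ?e)) ` nonneg_mean_one n \<subseteq> (\<lambda>f. f - ?e) ` (pairing_polytope n k \<inter> linear_restrictions n)"
      proof (intro image_subsetI)
        fix f assume f: "f \<in> nonneg_mean_one n"
        let ?g = "?e + c *\<^sub>R (f - ?e)"
        \<comment> \<open>The smoothing of \<open>\<one>\<close> is \<open>\<one>\<close>, so the polytope contains the segment from \<open>\<one>\<close> to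
          \<open>\<one> + a (f - \<one>)\<close>, on which the point with parameter \<open>c / a\<close> is the required one.\<close>
        have "?e \<in> pairing_polytope n k"
          using PQ eQ by force
        then have "(1 - c / a) *\<^sub>R ?e + (c / a) *\<^sub>R (?e + a *\<^sub>R (f - ?e)) \<in> pairing_polytope n k"
          using c PQ f unfolding pairing_polytope_def
          by (intro convexD_alt convex_convex_hull) simp_all
        moreover have "(1 - c / a) *\<^sub>R ?e + (c / a) *\<^sub>R (?e + a *\<^sub>R (f - ?e)) = ?g"
        proof -
          have "(c / a) *\<^sub>R a *\<^sub>R (f - ?e) = c *\<^sub>R (f - ?e)"
            using c by simp
          then show ?thesis
            by (simp add: scaleR_add_right scaleR_left_diff_distrib)
        qed
        ultimately have "?g \<in> pairing_polytope n k"
          by simp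
        moreover have "?g \<in> linear_restrictions n"
          using linear_restrictions_shift[OF n3, of f c] f by (simp add: nonneg_mean_one_def)
        ultimately show "c *\<^sub>R (f - ?e) \<in> (\<lambda>f. f - ?e) ` (pairing_polytope n k \<inter> linear_restrictions n)"
          by (intro image_eqI[of _ _ ?g]) simp_all
      qed
    qed
  qed
qed simp_all

end
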